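(* (Subject Reduction.) Let $(\mathcal S,\mathcal A,\mathcal R)$ be any Pure Type System. (i) For all contexts $\Gamma,\Delta$: if $\Gamma\ \mathsf{ok}$ and $\Gamma\to\to_{\beta_=}\Delta$, then $\Delta\ \mathsf{ok}$. (ii) For all contexts $\Gamma,\Delta$ and terms $M,N,A$: if $\Gamma\vdash M:A$, $\Gamma\to\to_{\beta_=}\Delta$ and $M\to_{\beta_=}N$, then $\Delta\vdash N:A$.
   Context: Syntax. Fix a type $\mathcal S$ of sorts (used as constants) and a countably infinite type $\mathcal V$ of variables with decidable equality and a fixed enumeration. Raw terms $\Lambda$ (NOT identified up to $\alpha$): $M,N,A,B::= s \mid x \mid \lambda[x:A]M \mid \Pi[x:A]B \mid M\cdot N$ with $s\in\mathcal S$, $x\in\mathcal V$. $\mathrm{fv}(M)$ is the (finite list of) free variables, where $\lambda[x:A]M$ and $\Pi[x:A]M$ bind $x$ in $M$ but not in $A$; $\mathrm{fv}(M)-x$ is $\mathrm{fv}(M)$ with $x$ removed. $\equiv$ is syntactic identity. Substitution (Stoughton). A substitution is a function $\sigma:\mathcal V\to\Lambda$; $\iota$ is the identity; $(\sigma,x:=N)$ maps $x$ to $N$ and any other $y$ to $\sigma y$. For a finite list $xs$ of variables, $X(\sigma,xs)$ is the first variable (in the enumeration) not occurring free in $\sigma y$ for any $y\in xs$. Define $s\bullet\sigma=s$, $x\bullet\sigma=\sigma x$, $(M\cdot N)\bullet\sigma=(M\bullet\sigma)\cdot(N\bullet\sigma)$, and for $Q\in\{\lambda,\Pi\}$, $(Q[x:A]M)\bullet\sigma=Q[y:A\bullet\sigma](M\bullet(\sigma,x:=y))$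 where $y=X(\sigma,\mathrm{fv}(M)-x)$. Write $M[x:=N]$ for $M\bullet(\iota,x:=N)$. $\alpha$-conversion $\sim_\alpha$ is inductively defined by: $s\sim_\alpha s$; $x\sim_\alpha x$; if $M\sim_\alpha M'$ and $N\sim_\alpha N'$ then $M\cdot N\sim_\alpha M'\cdot N'$; for $Q\in\{\lambda,\Pi\}$, if $A\sim_\alpha A'$ and $M[x:=y]\equiv M'[x':=y]$ for some $y\notin\mathrm{fv}(M)-x$, $y\notin\mathrm{fv}(M')-x'$, then $Q[x:A]M\sim_\alpha Q[x':A']M'$. $\beta$. $\to_\beta$ is the contextual closure (under both positions of application, and both the domain and the body of $\lambda$ and $\Pi$) of $(\lambda[x:A]M)\cdot N\triangleright_\beta M[x:=N]$. $\simeq_\beta$ is the least equivalence relation containing $\sim_\alpha$ and $\to_\beta$. $M\to_{\beta_=}N$ means $M\equiv N$ or $M\to_\beta N$. Pure Type System. It is specified by sorts $\mathcal S$, axioms $\mathcal A\subseteq\mathcal S^2$ and rules $\mathcal R\subseteq\mathcal S^3$ (arbitrary relations). Contexts are finite lists of pairs $(x,A)\in\mathcal V\times\Lambda$; $\Gamma,x:A$ extends $\Gamma$ by $(x,A)$; $\mathrm{dom}\,\Gamma$ is the list of its variables. $\Gamma\to\to_{\beta_=}\Delta$ means $\Gamma,\Delta$ have the same length and corresponding entries $(x,A)$, $(y,B)$ satisfy $x\equiv y$ and $A\to_{\beta_=}B$. The judgments $\Gamma\ \mathsf{ok}$ and $\Gamma\vdash M:A$ are mutually inductively defined by: - $[]\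 \mathsf{ok}$; if $\Gamma\ \mathsf{ok}$, $\Gamma\vdash A:s$ and $x\notin\mathrm{dom}\,\Gamma$ then $(\Gamma,x:A)\ \mathsf{ok}$. - (sort) if $\Gamma\ \mathsf{ok}$ and $\mathcal A\,s_1\,s_2$ then $\Gamma\vdash s_1:s_2$. - (var) if $\Gamma\ \mathsf{ok}$ and $(x,A)\in\Gamma$ then $\Gamma\vdash x:A$. - (prod) if $\Gamma\vdash A:s_1$, $\Gamma,y:A\vdash B[x:=y]:s_2$, $\mathcal R\,s_1\,s_2\,s_3$ and $y\notin\mathrm{fv}(B)-x$ then $\Gamma\vdash\Pi[x:A]B:s_3$. - (abs) if $\Gamma\vdash A:s_1$, $\Gamma,z:A\vdash M[x:=z]:B[y:=z]$, $\Gamma,z:A\vdash B[y:=z]:s_2$, $\mathcal R\,s_1\,s_2\,s_3$, $z\notin\mathrm{fv}(M)-x$ and $z\notin\mathrm{fv}(B)-y$ then $\Gamma\vdash\lambda[x:A]M:\Pi[y:A]B$. - (app) if $\Gamma\vdash M:\Pi[x:A]B$ and $\Gamma\vdash N:A$ then $\Gamma\vdash M\cdot N:B[x:=N]$. - (conv) if $\Gamma\vdash M:A$, $\Gamma\vdash B:s$ and $A\simeq_\beta B$ then $\Gamma\vdash M:B$. *)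

theory Defs
  imports Main
begin

text \<open>Variables: a countably infinite type together with a fixed enumeration.\<close>

class enumerated_var =
  fixes var_enum :: "nat \<Rightarrow> 'a"
  assumes bij_var_enum: "bij var_enum"

instantiation nat :: enumerated_var
begin

definition var_enum_nat :: "nat \<Rightarrow> nat" where
  "var_enum_nat n = n"

instance
  by standard (auto simp: var_enum_nat_def bij_def inj_def surj_def)

end

text \<open>Raw terms, not identified up to renaming of bound variables.  In \<open>Lam x A M\<close> and
  \<open>Prod x A M\<close> the variable \<open>x\<close> is bound in \<open>M\<close> but not in \<open>A\<close>.\<close>

datatype ('s, 'v) trm =
    Sort 's
  | Var 'v
  | Lam 'v "('s, 'v) trm" "('s, 'v) trm"
  | Prod 'v "('s, 'v) trm" "('s, 'v) trm"
  | App "('s, 'v) trm" "('s, 'v) trm"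

primrec fv :: "('s, 'v) trm \<Rightarrow> 'v list" where
  "fv (Sort s) = []"
| "fv (Var x) = [x]"
| "fv (Lam x A M) = fv A @ removeAll x (fv M)"
| "fv (Prod x A M) = fv A @ removeAll x (fv M)"
| "fv (App M N) = fv M @ fv N"

text \<open>Stoughton's simultaneous substitution.  Substitutions are arbitrary functions from
  variables to terms; the identity substitution is \<open>Var\<close>, and \<open>(\<sigma>, x := N)\<close> is the function
  update \<open>\<sigma>(x := N)\<close>.  The bound variable is always replaced by \<open>fresh_var \<sigma> xs\<close>, the first
  variable of the enumeration that is not free in \<open>\<sigma> y\<close> for any \<open>y\<close> in \<open>xs\<close>.\<close>

definition fresh_var ::
    "('v::enumerated_var \<Rightarrow> ('s, 'v) trm) \<Rightarrow> 'v list \<Rightarrow> 'v" where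
  "fresh_var \<sigma> xs = var_enum (LEAST n. \<forall>y\<in>set xs. var_enum n \<notin> set (fv (\<sigma> y)))"

primrec subst ::
    "('s, 'v::enumerated_var) trm \<Rightarrow> ('v \<Rightarrow> ('s, 'v) trm) \<Rightarrow> ('s, 'v) trm"
    (infixl "\<bullet>" 80) where
  "Sort s \<bullet> \<sigma> = Sort s"
| "Var x \<bullet> \<sigma> = \<sigma> x"
| "Lam x A M \<bullet> \<sigma> =
    (let y = fresh_var \<sigma> (removeAll x (fv M)) in Lam y (A \<bullet> \<sigma>) (M \<bullet> \<sigma>(x := Var y)))"
| "Prod x A M \<bullet> \<sigma> =
    (let y = fresh_var \<sigma> (removeAll x (fv M)) in Prod y (A \<bullet> \<sigma>) (M \<bullet> \<sigma>(x := Var y)))"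
| "App M N \<bullet> \<sigma> = App (M \<bullet> \<sigma>) (N \<bullet> \<sigma>)"

definition subst1 ::
    "('s, 'v::enumerated_var) trm \<Rightarrow> 'v \<Rightarrow> ('s, 'v) trm \<Rightarrow> ('s, 'v) trm"
    ("_[_ ::= _]" [1000, 0, 0] 1000) where
  "M[x ::= N] = M \<bullet> Var(x := N)"

inductive alpha ::
    "('s, 'v::enumerated_var) trm \<Rightarrow> ('s, 'v) trm \<Rightarrow> bool" (infix "\<sim>\<alpha>" 50) where
  alpha_Sort: "Sort s \<sim>\<alpha> Sort s"
| alpha_Var: "Var x \<sim>\<alpha> Var x"
| alpha_App: "M \<sim>\<alpha> M' \<Longrightarrow> N \<sim>\<alpha> N' \<Longrightarrow> App M N \<sim>\<alpha> App M' N'"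
| alpha_Lam: "A \<sim>\<alpha> A' \<Longrightarrow> M[x ::= Var y] = M'[x' ::= Var y] \<Longrightarrow>
    y \<notin> set (removeAll x (fv M)) \<Longrightarrow> y \<notin> set (removeAll x' (fv M')) \<Longrightarrow>
    Lam x A M \<sim>\<alpha> Lam x' A' M'"
| alpha_Prod: "A \<sim>\<alpha> A' \<Longrightarrow> M[x ::= Var y] = M'[x' ::= Var y] \<Longrightarrow>
    y \<notin> set (removeAll x (fv M)) \<Longrightarrow> y \<notin> set (removeAll x' (fv M')) \<Longrightarrow>
    Prod x A M \<sim>\<alpha> Prod x' A' M'"

inductive beta ::
    "('s, 'v::enumerated_var) trm \<Rightarrow> ('s, 'v) trm \<Rightarrow> bool" (infix "\<rightarrow>\<beta>" 50) where
  beta_redex: "App (Lam x A M) N \<rightarrow>\<beta> M[x ::= N]"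
| beta_AppL: "M \<rightarrow>\<beta> M' \<Longrightarrow> App M N \<rightarrow>\<beta> App M' N"
| beta_AppR: "N \<rightarrow>\<beta> N' \<Longrightarrow> App M N \<rightarrow>\<beta> App M N'"
| beta_LamL: "A \<rightarrow>\<beta> A' \<Longrightarrow> Lam x A M \<rightarrow>\<beta> Lam x A' M"
| beta_LamR: "M \<rightarrow>\<beta> M' \<Longrightarrow> Lam x A M \<rightarrow>\<beta> Lam x A M'"
| beta_ProdL: "A \<rightarrow>\<beta> A' \<Longrightarrow> Prod x A M \<rightarrow>\<beta> Prod x A' M"
| beta_ProdR: "M \<rightarrow>\<beta> M' \<Longrightarrow> Prod x A M \<rightarrow>\<beta> Prod x A M'"

definition beta_conv ::
    "('s, 'v::enumerated_var) trm \<Rightarrow> ('s, 'v) trm \<Rightarrow> bool" (infix "\<simeq>\<beta>" 50) where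
  "(\<simeq>\<beta>) = equivclp (\<lambda>M N. M \<sim>\<alpha> N \<or> M \<rightarrow>\<beta> N)"

definition beta_eq ::
    "('s, 'v::enumerated_var) trm \<Rightarrow> ('s, 'v) trm \<Rightarrow> bool" (infix "\<rightarrow>\<beta>\<^sub>=" 50) where
  "M \<rightarrow>\<beta>\<^sub>= N \<longleftrightarrow> M = N \<or> M \<rightarrow>\<beta> N"

text \<open>Contexts grow at the head: the extension of \<open>\<Gamma>\<close> by \<open>x : A\<close> is \<open>(x, A) # \<Gamma>\<close>.\<close>

type_synonym ('s, 'v) ctx = "('v \<times> ('s, 'v) trm) list"

abbreviation ctx_dom :: "('s, 'v) ctx \<Rightarrow> 'v list" where
  "ctx_dom \<Gamma> \<equiv> map fst \<Gamma>"

definition ctx_beta_eq ::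
    "('s, 'v::enumerated_var) ctx \<Rightarrow> ('s, 'v) ctx \<Rightarrow> bool" (infix "\<rightarrow>\<rightarrow>\<beta>\<^sub>=" 50) where
  "\<Gamma> \<rightarrow>\<rightarrow>\<beta>\<^sub>= \<Delta> \<longleftrightarrow> list_all2 (\<lambda>(x, A) (y, B). x = y \<and> A \<rightarrow>\<beta>\<^sub>= B) \<Gamma> \<Delta>"

text \<open>The judgments are parameterised by the axioms \<open>\<A>\<close> and rules \<open>\<R>\<close> of the Pure Type System;
  its sorts are the elements of the type \<open>'s\<close>.\<close>

inductive
  ctx_ok :: "('s \<Rightarrow> 's \<Rightarrow> bool) \<Rightarrow> ('s \<Rightarrow> 's \<Rightarrow> 's \<Rightarrow> bool) \<Rightarrow>
    ('s, 'v::enumerated_var) ctx \<Rightarrow> bool" and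
  typing :: "('s \<Rightarrow> 's \<Rightarrow> bool) \<Rightarrow> ('s \<Rightarrow> 's \<Rightarrow> 's \<Rightarrow> bool) \<Rightarrow>
    ('s, 'v::enumerated_var) ctx \<Rightarrow> ('s, 'v) trm \<Rightarrow> ('s, 'v) trm \<Rightarrow> bool"
  for \<A> :: "'s \<Rightarrow> 's \<Rightarrow> bool" and \<R> :: "'s \<Rightarrow> 's \<Rightarrow> 's \<Rightarrow> bool"
where
  ok_Nil: "ctx_ok \<A> \<R> []"
| ok_Cons: "ctx_ok \<A> \<R> \<Gamma> \<Longrightarrow> typing \<A> \<R> \<Gamma> A (Sort s) \<Longrightarrow> x \<notin> set (ctx_dom \<Gamma>) \<Longrightarrow>
    ctx_ok \<A> \<R> ((x, A) # \<Gamma>)"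
| ty_sort: "ctx_ok \<A> \<R> \<Gamma> \<Longrightarrow> \<A> s1 s2 \<Longrightarrow> typing \<A> \<R> \<Gamma> (Sort s1) (Sort s2)"
| ty_var: "ctx_ok \<A> \<R> \<Gamma> \<Longrightarrow> (x, A) \<in> set \<Gamma> \<Longrightarrow> typing \<A> \<R> \<Gamma> (Var x) A"
| ty_prod: "typing \<A> \<R> \<Gamma> A (Sort s1) \<Longrightarrow>
    typing \<A> \<R> ((y, A) # \<Gamma>) (B[x ::= Var y]) (Sort s2) \<Longrightarrow>
    \<R> s1 s2 s3 \<Longrightarrow> y \<notin> set (removeAll x (fv B)) \<Longrightarrow>
    typing \<A> \<R> \<Gamma> (Prod x A B) (Sort s3)"
| ty_abs: "typing \<A> \<R> \<Gamma> A (Sort s1) \<Longrightarrow>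
    typing \<A> \<R> ((z, A) # \<Gamma>) (M[x ::= Var z]) (B[y ::= Var z]) \<Longrightarrow>
    typing \<A> \<R> ((z, A) # \<Gamma>) (B[y ::= Var z]) (Sort s2) \<Longrightarrow>
    \<R> s1 s2 s3 \<Longrightarrow> z \<notin> set (removeAll x (fv M)) \<Longrightarrow> z \<notin> set (removeAll y (fv B)) \<Longrightarrow>
    typing \<A> \<R> \<Gamma> (Lam x A M) (Prod y A B)"
| ty_app: "typing \<A> \<R> \<Gamma> M (Prod x A B) \<Longrightarrow> typing \<A> \<R> \<Gamma> N A \<Longrightarrow>
    typing \<A> \<R> \<Gamma> (App M N) (B[x ::= N])"
| ty_conv: "typing \<A> \<R> \<Gamma> M A \<Longrightarrow> typing \<A> \<R> \<Gamma> B (Sort s) \<Longrightarrow> A \<simeq>\<beta> B \<Longrightarrow> typing \<A> \<R> \<Gamma> M B"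

end

theory Submission imports Defs "HOL-Library.Confluence" begin

text \<open>The judgment is transferred to de Bruijn terms.  Substituting into a raw term gives a result
  that depends only on the de Bruijn translation of that term, so \<open>\<alpha>\<close>-convertible terms are exactly
  those with the same translation, and every reduction of a translation lifts to a reduction of the
  named term.  A named context maps its variables to their positions, and a named derivation
  translates rule by rule.  Conversely, a de Bruijn derivation gives for every named subject some
  named type with the right translation; type correctness allows one to convert to any other
  representative of it.

  On the de Bruijn side, confluence makes \<open>\<Pi>\<close> injective up to conversion, and subject reduction
  follows from generation, substitution and type correctness.\<close>

section \<open>De Bruijn terms\<close>

text \<open>A direct induction on raw terms is blocked by names: contraction renames bound variables
  by a fixed first-fresh choice, the binder rules type a body only after some variable has been
  substituted for its bound one, and a type can be exchanged for an \<alpha>-variant only by the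
  conversion rule, which demands that the new type be typed itself. De Bruijn terms separate these
  difficulties from subject reduction and confine them to the translation back. There the subject
  may be any representative, since the induction quantifies over it; a change of representative on
  the type side always costs a typing derivation. Both parts of the theorem transfer smoothly
  because reducing a context keeps its variables, so the same translation of terms serves \<Gamma>
  and \<Delta>.\<close>

datatype quant = QLam | QPi

text \<open>One tagged constructor covers both binders, since substitution and congruence treat them
  alike; only redexes and typing rules tell them apart.\<close>

datatype 's dtrm =
    DSort 's
  | DVar nat
  | DBind quant "'s dtrm" "'s dtrm"
  | DApp "'s dtrm" "'s dtrm"

abbreviation DLam :: "'s dtrm \<Rightarrow> 's dtrm \<Rightarrow> 's dtrm" where
  "DLam \<equiv> DBind QLam"

abbreviation DPi :: "'s dtrm \<Rightarrow> 's dtrm \<Rightarrow> 's dtrm" where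
  "DPi \<equiv> DBind QPi"

definition up_ren :: "(nat \<Rightarrow> nat) \<Rightarrow> nat \<Rightarrow> nat" where
  "up_ren r = case_nat 0 (Suc \<circ> r)"

text \<open>Renaming gets its own recursion because \<open>up\<close> shifts the values of a
  substitution; with \<open>shift\<close> at hand, \<open>dsub\<close> is structurally
  recursive.\<close>

primrec dren :: "(nat \<Rightarrow> nat) \<Rightarrow> 's dtrm \<Rightarrow> 's dtrm" where
  "dren r (DSort s) = DSort s"
| "dren r (DVar i) = DVar (r i)"
| "dren r (DBind q A M) = DBind q (dren r A) (dren (up_ren r) M)"
| "dren r (DApp M N) = DApp (dren r M) (dren r N)"

abbreviation shift :: "'s dtrm \<Rightarrow> 's dtrm" where
  "shift \<equiv> dren Suc"

definition up :: "(nat \<Rightarrow> 's dtrm) \<Rightarrow> nat \<Rightarrow> 's dtrm" where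
  "up \<sigma> = case_nat (DVar 0) (shift \<circ> \<sigma>)"

primrec dsub :: "(nat \<Rightarrow> 's dtrm) \<Rightarrow> 's dtrm \<Rightarrow> 's dtrm" where
  "dsub \<sigma> (DSort s) = DSort s"
| "dsub \<sigma> (DVar i) = \<sigma> i"
| "dsub \<sigma> (DBind q A M) = DBind q (dsub \<sigma> A) (dsub (up \<sigma>) M)"
| "dsub \<sigma> (DApp M N) = DApp (dsub \<sigma> M) (dsub \<sigma> N)"

definition dinst :: "'s dtrm \<Rightarrow> 's dtrm \<Rightarrow> 's dtrm" where
  "dinst M N = dsub (case_nat N DVar) M"

primrec dfv :: "'s dtrm \<Rightarrow> nat set" where
  "dfv (DSort s) = {}"
| "dfv (DVar i) = {i}"
| "dfv (DBind q A M) = dfv A \<union> {i. Suc i \<in> dfv M}"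
| "dfv (DApp M N) = dfv M \<union> dfv N"

section \<open>Algebra of renamings and substitutions\<close>

lemma up_simps [simp]: "up \<sigma> 0 = DVar 0" "up \<sigma> (Suc i) = shift (\<sigma> i)"
  and up_ren_simps [simp]: "up_ren r 0 = 0" "up_ren r (Suc i) = Suc (r i)"
  by (simp_all add: up_def up_ren_def)

lemma dren_eq_dsub: "dren r M = dsub (DVar \<circ> r) (M :: 's dtrm)"
proof (induction M arbitrary: r)
  case (DBind q A M)
  have "DVar \<circ> up_ren r = up (DVar \<circ> r :: nat \<Rightarrow> 's dtrm)"
    by (rule ext) (simp add: up_def up_ren_def split: nat.split)
  then show ?case by (simp only: dren.simps dsub.simps DBind.IH)
qed simp_all

lemma dsub_cong: "(\<And>i. i \<in> dfv M \<Longrightarrow> \<sigma> i = \<tau> i) \<Longrightarrow> dsub \<sigma> M = dsub \<tau> M"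
proof (induction M arbitrary: \<sigma> \<tau>)
  case (DBind q A M)
  have "dsub \<sigma> A = dsub \<tau> A"
    by (rule DBind.IH(1)) (simp add: DBind.prems)
  moreover have "dsub (up \<sigma>) M = dsub (up \<tau>) M"
    by (rule DBind.IH(2)) (auto simp: up_def DBind.prems split: nat.split)
  ultimately show ?case by simp
next
  case (DApp M N)
  have "dsub \<sigma> M = dsub \<tau> M" "dsub \<sigma> N = dsub \<tau> N"
    by (rule DApp.IH; simp add: DApp.prems)+
  then show ?case by simp
qed simp_all

lemma dsub_DVar [simp]: "dsub DVar M = M"
proof (induction M)
  case (DBind q A M)
  have "up DVar = (DVar :: nat \<Rightarrow> 'a dtrm)"
    by (rule ext) (simp add: up_def split: nat.split)
  then show ?case by (simp only: dren.simps dsub.simps DBind.IH)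
qed simp_all

text \<open>The composition laws come in a fixed order. Under a binder each requires
  \<open>up\<close> to commute with the composition in question, and that follows from the laws
  already proved.\<close>

lemma dsub_dren: "dsub \<sigma> (dren r M) = dsub (\<sigma> \<circ> r) M"
proof (induction M arbitrary: \<sigma> r)
  case (DBind q A M)
  have "up \<sigma> \<circ> up_ren r = up (\<sigma> \<circ> r)"
    by (rule ext) (simp add: up_def up_ren_def split: nat.split)
  then show ?case by (simp only: dren.simps dsub.simps DBind.IH)
qed simp_all

lemma dren_dren: "dren r (dren r' M) = dren (r \<circ> r') M"
  by (simp add: dren_eq_dsub[of r] dren_eq_dsub[of "r \<circ> r'"] dsub_dren comp_assoc)

lemma dren_dsub: "dren r (dsub \<sigma> M) = dsub (dren r \<circ> \<sigma>) M"
proof (induction M arbitrary: \<sigma> r)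
  case (DBind q A M)
  have "dren (up_ren r) \<circ> up \<sigma> = up (dren r \<circ> \<sigma>)"
    by (rule ext) (simp add: up_def dren_dren o_def split: nat.split)
  then show ?case by (simp only: dren.simps dsub.simps DBind.IH)
qed simp_all

lemma dsub_dsub: "dsub \<tau> (dsub \<sigma> M) = dsub (dsub \<tau> \<circ> \<sigma>) M"
proof (induction M arbitrary: \<sigma> \<tau>)
  case (DBind q A M)
  have "dsub (up \<tau>) \<circ> up \<sigma> = up (dsub \<tau> \<circ> \<sigma>)"
    by (rule ext) (simp add: up_def dren_dsub dsub_dren o_def split: nat.split)
  then show ?case by (simp only: dren.simps dsub.simps DBind.IH)
qed simp_all

lemma dinst_shift [simp]: "dinst (shift M) N = M"
  by (simp add: dinst_def dsub_dren o_def)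

lemma dsub_up_shift: "dsub (up \<sigma>) (shift M) = shift (dsub \<sigma> M)"
  by (simp add: dsub_dren dren_dsub o_def)

lemma dren_up_shift: "dren (up_ren r) (shift M) = shift (dren r M)"
  by (simp add: dren_dren o_def)

lemma dsub_dinst: "dsub \<sigma> (dinst M N) = dinst (dsub (up \<sigma>) M) (dsub \<sigma> N)"
proof -
  have "dsub \<sigma> \<circ> case_nat N DVar = dsub (case_nat (dsub \<sigma> N) DVar) \<circ> up \<sigma>"
    by (rule ext) (simp add: up_def dsub_dren o_def split: nat.split)
  then show ?thesis by (simp add: dinst_def dsub_dsub)
qed

lemma up_comp_DVar: "up (DVar \<circ> r) = DVar \<circ> up_ren r"
  by (rule ext) (simp add: up_def up_ren_def split: nat.split)

lemma dren_dinst: "dren r (dinst M N) = dinst (dren (up_ren r) M) (dren r N)"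
  by (simp add: dren_eq_dsub dsub_dinst up_comp_DVar)

lemma dfv_dren: "dfv (dren r M) = r ` dfv M"
proof (induction M arbitrary: r)
  case (DBind q A M)
  have "{i. Suc i \<in> up_ren r ` dfv M} = r ` {i. Suc i \<in> dfv M}" (is "?L = ?R")
  proof
    show "?L \<subseteq> ?R" by (auto simp: up_ren_def split: nat.splits)
    show "?R \<subseteq> ?L" by (force simp: image_iff)
  qed
  then show ?case using DBind by (simp add: image_Un)
qed auto

section \<open>Confluence\<close>

inductive dbeta :: "'s dtrm \<Rightarrow> 's dtrm \<Rightarrow> bool" where
  dbeta_redex: "dbeta (DApp (DLam A M) N) (dinst M N)"
| dbeta_AppL: "dbeta M M' \<Longrightarrow> dbeta (DApp M N) (DApp M' N)"
| dbeta_AppR: "dbeta N N' \<Longrightarrow> dbeta (DApp M N) (DApp M N')"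
| dbeta_BindL: "dbeta A A' \<Longrightarrow> dbeta (DBind q A M) (DBind q A' M)"
| dbeta_BindR: "dbeta M M' \<Longrightarrow> dbeta (DBind q A M) (DBind q A M')"

text \<open>Parallel reduction in the style of Tait and Martin-Loef. The domain \<open>A\<close> of
  a contracted redex disappears, so \<open>par_redex\<close> asks for no reduct of it.\<close>

inductive par :: "'s dtrm \<Rightarrow> 's dtrm \<Rightarrow> bool" where
  par_Sort: "par (DSort s) (DSort s)"
| par_Var: "par (DVar i) (DVar i)"
| par_Bind: "par A A' \<Longrightarrow> par M M' \<Longrightarrow> par (DBind q A M) (DBind q A' M')"
| par_App: "par M M' \<Longrightarrow> par N N' \<Longrightarrow> par (DApp M N) (DApp M' N')"
| par_redex: "par M M' \<Longrightarrow> par N N' \<Longrightarrow> par (DApp (DLam A M) N) (dinst M' N')"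

lemma par_refl: "par M M"
  by (induction M) (auto intro: par.intros)

lemma dbeta_imp_par: "dbeta M N \<Longrightarrow> par M N"
  by (induction rule: dbeta.induct) (auto intro: par.intros par_refl)

lemma rtranclp_dbeta_DBind:
  assumes "dbeta\<^sup>*\<^sup>* A A'" "dbeta\<^sup>*\<^sup>* M M'"
  shows "dbeta\<^sup>*\<^sup>* (DBind q A M) (DBind q A' M')"
proof -
  have "dbeta\<^sup>*\<^sup>* (DBind q A M) (DBind q A' M)"
    using assms(1) by induction (auto intro: rtranclp.rtrancl_into_rtrancl dbeta_BindL)
  also have "dbeta\<^sup>*\<^sup>* (DBind q A' M) (DBind q A' M')"
    using assms(2) by induction (auto intro: rtranclp.rtrancl_into_rtrancl dbeta_BindR)
  finally show ?thesis .
qed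

lemma rtranclp_dbeta_DApp:
  assumes "dbeta\<^sup>*\<^sup>* M M'" "dbeta\<^sup>*\<^sup>* N N'"
  shows "dbeta\<^sup>*\<^sup>* (DApp M N) (DApp M' N')"
proof -
  have "dbeta\<^sup>*\<^sup>* (DApp M N) (DApp M' N)"
    using assms(1) by induction (auto intro: rtranclp.rtrancl_into_rtrancl dbeta_AppL)
  also have "dbeta\<^sup>*\<^sup>* (DApp M' N) (DApp M' N')"
    using assms(2) by induction (auto intro: rtranclp.rtrancl_into_rtrancl dbeta_AppR)
  finally show ?thesis .
qed

lemma par_imp_rtranclp_dbeta: "par M N \<Longrightarrow> dbeta\<^sup>*\<^sup>* M N"
proof (induction rule: par.induct)
  case (par_redex M M' N N' A)
  have "dbeta\<^sup>*\<^sup>* (DApp (DLam A M) N) (DApp (DLam A M') N')"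
    using par_redex.IH by (intro rtranclp_dbeta_DApp rtranclp_dbeta_DBind) auto
  then show ?case by (rule rtranclp.rtrancl_into_rtrancl) (rule dbeta_redex)
qed (auto intro: rtranclp_dbeta_DBind rtranclp_dbeta_DApp)

lemma rtranclp_par: "par\<^sup>*\<^sup>* = dbeta\<^sup>*\<^sup>*"
proof (rule antisym)
  show "par\<^sup>*\<^sup>* \<le> dbeta\<^sup>*\<^sup>*"
    using rtranclp_mono[of par "dbeta\<^sup>*\<^sup>*"] par_imp_rtranclp_dbeta by auto
  show "dbeta\<^sup>*\<^sup>* \<le> par\<^sup>*\<^sup>*"
    by (rule rtranclp_mono) (auto intro: dbeta_imp_par)
qed

lemma dbeta_dsub: "dbeta M N \<Longrightarrow> dbeta (dsub \<sigma> M) (dsub \<sigma> N)"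
  by (induction arbitrary: \<sigma> rule: dbeta.induct) (auto simp: dsub_dinst intro: dbeta.intros)

lemma par_dren: "par M N \<Longrightarrow> par (dren r M) (dren r N)"
  by (induction arbitrary: r rule: par.induct) (auto simp: dren_dinst intro: par.intros)

lemma par_dsub:
  "par M N \<Longrightarrow> (\<And>i. par (\<sigma> i) (\<tau> i)) \<Longrightarrow> par (dsub \<sigma> M) (dsub \<tau> N)"
proof (induction arbitrary: \<sigma> \<tau> rule: par.induct)
  case (par_Bind A A' M M' q)
  have "par (up \<sigma> i) (up \<tau> i)" for i
    using par_Bind.prems by (auto simp: up_def intro: par_dren par_Var split: nat.split)
  then show ?case using par_Bind by (auto intro: par.intros)
next
  case (par_redex M M' N N' A)
  have "par (up \<sigma> i) (up \<tau> i)" for i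
    using par_redex.prems by (auto simp: up_def intro: par_dren par_Var split: nat.split)
  then show ?case using par_redex by (auto simp: dsub_dinst intro: par.intros)
qed (auto intro: par.intros)

lemma par_dinst: "par M M' \<Longrightarrow> par N N' \<Longrightarrow> par (dinst M N) (dinst M' N')"
  unfolding dinst_def by (rule par_dsub) (auto intro: par_Var split: nat.split)

fun complete_dev :: "'s dtrm \<Rightarrow> 's dtrm" where
  "complete_dev (DSort s) = DSort s"
| "complete_dev (DVar i) = DVar i"
| "complete_dev (DBind q A M) = DBind q (complete_dev A) (complete_dev M)"
| "complete_dev (DApp (DBind QLam A M) N) = dinst (complete_dev M) (complete_dev N)"
| "complete_dev (DApp M N) = DApp (complete_dev M) (complete_dev N)"

text \<open>Takahashi's triangle property: the target depends on \<open>M\<close> alone, so any two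
  parallel reducts of \<open>M\<close> meet there after one further step each.\<close>

lemma par_complete_dev: "par M N \<Longrightarrow> par N (complete_dev M)"
proof (induction rule: par.induct)
  case (par_App M M' N N')
  show ?case
  proof (cases "\<exists>A P. M = DLam A P")
    case True
    \<comment> \<open>Here \<open>complete_dev\<close> contracts a redex that \<open>par_App\<close>
      left alone. As \<open>M'\<close> is again an abstraction, \<open>par_redex\<close> can still
      contract it.\<close>
    then obtain A P where M: "M = DLam A P" by blast
    with par_App.hyps(1) obtain A' P' where M': "M' = DLam A' P'"
      by (auto elim: par.cases)
    have "par P' (complete_dev P)"
      using par_App.IH(1) M M' by (auto elim: par.cases)
    then show ?thesis using M M' par_App.IH(2) by (auto intro: par_redex)
  next
    case False
    then have "complete_dev (DApp M N) = DApp (complete_dev M) (complete_dev N)"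
    proof (cases M)
      case (DBind q A P)
      then show ?thesis using False by (cases q) auto
    qed auto
    then show ?thesis using par_App by (auto intro: par.par_App)
  qed
qed (auto intro: par.intros par_dinst)

lemma confluentp_dbeta: "confluentp dbeta"
proof -
  have "strong_confluentp par"
    by (rule strong_confluentpI) (meson par_complete_dev r_into_rtranclp sup2I1)
  then have "confluentp par" by (rule strong_confluentp_imp_confluentp)
  then show ?thesis by (simp add: confluentp_def rtranclp_conversep rtranclp_par)
qed

section \<open>Church-Rosser and the structure of conversion\<close>

abbreviation dconv :: "'s dtrm \<Rightarrow> 's dtrm \<Rightarrow> bool" where
  "dconv \<equiv> equivclp dbeta"

text \<open>The Church-Rosser property. The facts about conversion below are obtained by passing to
  a common reduct, so that they need proof for reductions only.\<close>

lemma dconv_joinable: "dconv M N \<Longrightarrow> \<exists>P. dbeta\<^sup>*\<^sup>* M P \<and> dbeta\<^sup>*\<^sup>* N P"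
  unfolding semiconfluentp_equivclp[OF confluentp_imp_semiconfluentp[OF confluentp_dbeta]]
  by (auto simp: rtranclp_conversep)

lemma joinable_dconv: "dbeta\<^sup>*\<^sup>* M P \<Longrightarrow> dbeta\<^sup>*\<^sup>* N P \<Longrightarrow> dconv M N"
  using r_OO_conversep_into_equivclp[of dbeta] by (auto simp: rtranclp_conversep)

lemma rtranclp_dbeta_dsub: "dbeta\<^sup>*\<^sup>* M N \<Longrightarrow> dbeta\<^sup>*\<^sup>* (dsub \<sigma> M) (dsub \<sigma> N)"
  by (induction rule: rtranclp_induct) (auto intro: rtranclp.rtrancl_into_rtrancl dbeta_dsub)

lemma dconv_dsub: "dconv M N \<Longrightarrow> dconv (dsub \<sigma> M) (dsub \<sigma> N)"
  by (meson dconv_joinable joinable_dconv rtranclp_dbeta_dsub)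

lemma dconv_dren: "dconv M N \<Longrightarrow> dconv (dren r M) (dren r N)"
  by (simp add: dren_eq_dsub dconv_dsub)

lemma dconv_DBind: "dconv A A' \<Longrightarrow> dconv M M' \<Longrightarrow> dconv (DBind q A M) (DBind q A' M')"
  by (meson dconv_joinable joinable_dconv rtranclp_dbeta_DBind)

lemma dconv_dinst:
  assumes "dconv M M'" "dconv N N'"
  shows "dconv (dinst M N) (dinst M' N')"
proof -
  \<comment> \<open>Substitution may copy \<open>N\<close> many times. A step in \<open>N\<close> is
    then still a single \<open>par\<close> step of the instance, though not a single
    \<open>dbeta\<close> step.\<close>
  have conv: "par\<^sup>*\<^sup>* (dinst M N) (dinst M' N')" if "par\<^sup>*\<^sup>* M M'" "par\<^sup>*\<^sup>* N N'" for M M' N N' :: "'a dtrm"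
  proof -
    have "par\<^sup>*\<^sup>* (dinst M N) (dinst M' N)"
      using that(1) by induction (auto intro: rtranclp.rtrancl_into_rtrancl par_dinst par_refl)
    also have "par\<^sup>*\<^sup>* (dinst M' N) (dinst M' N')"
      using that(2) by induction (auto intro: rtranclp.rtrancl_into_rtrancl par_dinst par_refl)
    finally show ?thesis .
  qed
  obtain P Q where "dbeta\<^sup>*\<^sup>* M P" "dbeta\<^sup>*\<^sup>* M' P" "dbeta\<^sup>*\<^sup>* N Q" "dbeta\<^sup>*\<^sup>* N' Q"
    using assms by (meson dconv_joinable)
  then show ?thesis
    using conv[of M P N Q] conv[of M' P N' Q] unfolding rtranclp_par by (blast intro: joinable_dconv)
qed

lemma rtranclp_dbeta_DBindD:
  "dbeta\<^sup>*\<^sup>* (DBind q A M) P \<Longrightarrow> \<exists>A' M'. P = DBind q A' M' \<and> dbeta\<^sup>*\<^sup>* A A' \<and> dbeta\<^sup>*\<^sup>* M M'"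
proof (induction rule: rtranclp_induct)
  case (step y z)
  then obtain A' M' where y: "y = DBind q A' M'" "dbeta\<^sup>*\<^sup>* A A'" "dbeta\<^sup>*\<^sup>* M M'" by blast
  from step.hyps(2) show ?case unfolding y(1)
    by cases (use y in \<open>auto intro: rtranclp.rtrancl_into_rtrancl\<close>)
qed auto

text \<open>No step removes an outermost binder, so a common reduct is again a binder, reached
  separately in domain and body.\<close>

lemma dconv_DBind_inj:
  assumes "dconv (DBind q A M) (DBind q A' M')"
  shows "dconv A A'" "dconv M M'"
proof -
  from dconv_joinable[OF assms] obtain P
    where "dbeta\<^sup>*\<^sup>* (DBind q A M) P" "dbeta\<^sup>*\<^sup>* (DBind q A' M') P" by blast
  then obtain B N where "dbeta\<^sup>*\<^sup>* A B" "dbeta\<^sup>*\<^sup>* A' B" "dbeta\<^sup>*\<^sup>* M N" "dbeta\<^sup>*\<^sup>* M' N"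
    by (force dest: rtranclp_dbeta_DBindD)
  then show "dconv A A'" "dconv M M'" by (auto intro: joinable_dconv)
qed

section \<open>The metatheory of de Bruijn typing\<close>

text \<open>An entry is a term over the tail behind it, hence one \<open>shift\<close> for each
  entry passed and one for the entry itself. The default \<open>undefined\<close> is harmless, as
  only indices below the length are looked up.\<close>

primrec lookup :: "'s dtrm list \<Rightarrow> nat \<Rightarrow> 's dtrm" where
  "lookup [] i = undefined"
| "lookup (A # \<Gamma>) i = shift (case i of 0 \<Rightarrow> A | Suc j \<Rightarrow> lookup \<Gamma> j)"

text \<open>The premise \<open>\<Gamma> \<turnstile> A : s\<close> of the application rule is redundant by type correctness.  It is
  there for the translation back to named terms, where a conversion is needed to make the type
  of \<open>N\<close> syntactically equal to the domain of the type of \<open>M\<close>.\<close>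

inductive
  dok :: "('s \<Rightarrow> 's \<Rightarrow> bool) \<Rightarrow> ('s \<Rightarrow> 's \<Rightarrow> 's \<Rightarrow> bool) \<Rightarrow> 's dtrm list \<Rightarrow> bool" and
  dty :: "('s \<Rightarrow> 's \<Rightarrow> bool) \<Rightarrow> ('s \<Rightarrow> 's \<Rightarrow> 's \<Rightarrow> bool) \<Rightarrow> 's dtrm list \<Rightarrow> 's dtrm \<Rightarrow>
    's dtrm \<Rightarrow> bool"
  for \<A> :: "'s \<Rightarrow> 's \<Rightarrow> bool" and \<R> :: "'s \<Rightarrow> 's \<Rightarrow> 's \<Rightarrow> bool"
where
  dok_Nil: "dok \<A> \<R> []"
| dok_Cons: "dok \<A> \<R> \<Gamma> \<Longrightarrow> dty \<A> \<R> \<Gamma> A (DSort s) \<Longrightarrow> dok \<A> \<R> (A # \<Gamma>)"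
| dty_Sort: "dok \<A> \<R> \<Gamma> \<Longrightarrow> \<A> s1 s2 \<Longrightarrow> dty \<A> \<R> \<Gamma> (DSort s1) (DSort s2)"
| dty_Var: "dok \<A> \<R> \<Gamma> \<Longrightarrow> i < length \<Gamma> \<Longrightarrow> dty \<A> \<R> \<Gamma> (DVar i) (lookup \<Gamma> i)"
| dty_Pi: "dty \<A> \<R> \<Gamma> A (DSort s1) \<Longrightarrow> dty \<A> \<R> (A # \<Gamma>) B (DSort s2) \<Longrightarrow> \<R> s1 s2 s3 \<Longrightarrow>
    dty \<A> \<R> \<Gamma> (DPi A B) (DSort s3)"
| dty_Lam: "dty \<A> \<R> \<Gamma> A (DSort s1) \<Longrightarrow> dty \<A> \<R> (A # \<Gamma>) M B \<Longrightarrow>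
    dty \<A> \<R> (A # \<Gamma>) B (DSort s2) \<Longrightarrow> \<R> s1 s2 s3 \<Longrightarrow> dty \<A> \<R> \<Gamma> (DLam A M) (DPi A B)"
| dty_App: "dty \<A> \<R> \<Gamma> M (DPi A B) \<Longrightarrow> dty \<A> \<R> \<Gamma> N A \<Longrightarrow> dty \<A> \<R> \<Gamma> A (DSort s) \<Longrightarrow>
    dty \<A> \<R> \<Gamma> (DApp M N) (dinst B N)"
| dty_conv: "dty \<A> \<R> \<Gamma> M A \<Longrightarrow> dty \<A> \<R> \<Gamma> B (DSort s) \<Longrightarrow> dconv A B \<Longrightarrow> dty \<A> \<R> \<Gamma> M B"

definition dbeta_eq :: "'s dtrm \<Rightarrow> 's dtrm \<Rightarrow> bool" where
  "dbeta_eq M N \<longleftrightarrow> M = N \<or> dbeta M N"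

lemma dbeta_eq_refl [simp]: "dbeta_eq M M"
  by (simp add: dbeta_eq_def)

lemma dbeta_eq_dconv: "dbeta_eq M N \<Longrightarrow> dconv M N" "dbeta_eq M N \<Longrightarrow> dconv N M"
  by (auto simp: dbeta_eq_def intro: equivclp_sym)

abbreviation dctx_step :: "'s dtrm list \<Rightarrow> 's dtrm list \<Rightarrow> bool" where
  "dctx_step \<equiv> list_all2 dbeta_eq"

lemma lookup_dctx_step:
  "dctx_step \<Gamma> \<Delta> \<Longrightarrow> i < length \<Gamma> \<Longrightarrow> dconv (lookup \<Gamma> i) (lookup \<Delta> i)"
proof (induction arbitrary: i rule: list_all2_induct)
  case (Cons A \<Gamma> B \<Delta>)
  then show ?case by (auto intro: dconv_dren dbeta_eq_dconv split: nat.split)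
qed simp

context
  fixes \<A> :: "'s \<Rightarrow> 's \<Rightarrow> bool" and \<R> :: "'s \<Rightarrow> 's \<Rightarrow> 's \<Rightarrow> bool"
begin

lemma dty_imp_dok: "dty \<A> \<R> \<Gamma> M A \<Longrightarrow> dok \<A> \<R> \<Gamma>"
  by (induction rule: dok_dty.inducts(2)[where ?P1.0 = "\<lambda>_. True"]) auto

lemma dty_dfv: "dty \<A> \<R> \<Gamma> M A \<Longrightarrow> dfv M \<subseteq> {..<length \<Gamma>}"
  by (induction rule: dok_dty.inducts(2)[where ?P1.0 = "\<lambda>_. True"]) auto

section \<open>Renaming and substitution in typing derivations\<close>

lemma lookup_up_ren:
  assumes "\<And>i. i < length \<Gamma> \<Longrightarrow> r i < length \<Delta> \<and> lookup \<Delta> (r i) = dren r (lookup \<Gamma> i)"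
    and "i < length (A # \<Gamma>)"
  shows "up_ren r i < length (dren r A # \<Delta>) \<and>
    lookup (dren r A # \<Delta>) (up_ren r i) = dren (up_ren r) (lookup (A # \<Gamma>) i)"
  using assms by (cases i) (auto simp: dren_up_shift)

text \<open>Weakening by one entry is not stable under binders, where the inserted entry is no
  longer innermost. Arbitrary renamings between contexts are, by
  \<open>lookup_up_ren\<close>.\<close>

lemma dty_dren:
  "dty \<A> \<R> \<Gamma> M A \<Longrightarrow> dok \<A> \<R> \<Delta> \<Longrightarrow>
    (\<And>i. i < length \<Gamma> \<Longrightarrow> r i < length \<Delta> \<and> lookup \<Delta> (r i) = dren r (lookup \<Gamma> i)) \<Longrightarrow>
    dty \<A> \<R> \<Delta> (dren r M) (dren r A)"
proof (induction arbitrary: \<Delta> r rule: dok_dty.inducts(2)[where ?P1.0 = "\<lambda>_. True"])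
  case (dty_Var \<Gamma> i)
  then show ?case by (metis dok_dty.dty_Var dren.simps(2))
next
  case (dty_Pi \<Gamma> A s1 B s2 s3)
  have A: "dty \<A> \<R> \<Delta> (dren r A) (DSort s1)"
    using dty_Pi.IH(1)[OF dty_Pi.prems] by simp
  then have ok: "dok \<A> \<R> (dren r A # \<Delta>)" by (rule dok_Cons[OF dty_Pi.prems(1)])
  have "dty \<A> \<R> (dren r A # \<Delta>) (dren (up_ren r) B) (dren (up_ren r) (DSort s2))"
    by (rule dty_Pi.IH(2)[OF ok]) (rule lookup_up_ren[OF dty_Pi.prems(2)])
  then show ?case using A dty_Pi.hyps by (auto intro: dok_dty.dty_Pi)
next
  case (dty_Lam \<Gamma> A s1 M B s2 s3)
  have A: "dty \<A> \<R> \<Delta> (dren r A) (DSort s1)"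
    using dty_Lam.IH(1)[OF dty_Lam.prems] by simp
  then have ok: "dok \<A> \<R> (dren r A # \<Delta>)" by (rule dok_Cons[OF dty_Lam.prems(1)])
  have "dty \<A> \<R> (dren r A # \<Delta>) (dren (up_ren r) M) (dren (up_ren r) B)"
    by (rule dty_Lam.IH(2)[OF ok]) (rule lookup_up_ren[OF dty_Lam.prems(2)])
  moreover have "dty \<A> \<R> (dren r A # \<Delta>) (dren (up_ren r) B) (dren (up_ren r) (DSort s2))"
    by (rule dty_Lam.IH(3)[OF ok]) (rule lookup_up_ren[OF dty_Lam.prems(2)])
  ultimately show ?case using A dty_Lam.hyps by (auto intro: dok_dty.dty_Lam)
next
  case (dty_App \<Gamma> M A B N s)
  have "dty \<A> \<R> \<Delta> (dren r M) (dren r (DPi A B))" "dty \<A> \<R> \<Delta> (dren r N) (dren r A)"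
    "dty \<A> \<R> \<Delta> (dren r A) (dren r (DSort s))"
    by (rule dty_App.IH[OF dty_App.prems]; assumption)+
  then show ?case by (auto simp: dren_dinst intro: dok_dty.dty_App)
next
  case (dty_conv \<Gamma> M A B s)
  have "dty \<A> \<R> \<Delta> (dren r M) (dren r A)" "dty \<A> \<R> \<Delta> (dren r B) (dren r (DSort s))"
    by (rule dty_conv.IH[OF dty_conv.prems]; assumption)+
  then show ?case using dty_conv.hyps by (auto intro: dok_dty.dty_conv dconv_dren)
qed (auto intro: dok_dty.intros)

lemma dty_weaken: "dty \<A> \<R> \<Gamma> M A \<Longrightarrow> dok \<A> \<R> (C # \<Gamma>) \<Longrightarrow> dty \<A> \<R> (C # \<Gamma>) (shift M) (shift A)"
  by (erule dty_dren) auto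

text \<open>Under a binder the values of \<sigma> are weakened, which is why renaming is settled
  before substitution.\<close>

lemma dty_up:
  assumes \<sigma>: "\<And>i. i < length \<Gamma> \<Longrightarrow> dty \<A> \<R> \<Delta> (\<sigma> i) (dsub \<sigma> (lookup \<Gamma> i))"
    and ok: "dok \<A> \<R> (dsub \<sigma> A # \<Delta>)" and i: "i < length (A # \<Gamma>)"
  shows "dty \<A> \<R> (dsub \<sigma> A # \<Delta>) (up \<sigma> i) (dsub (up \<sigma>) (lookup (A # \<Gamma>) i))"
proof (cases i)
  case 0
  then show ?thesis using dty_Var[OF ok, of 0] by (simp add: dsub_up_shift)
next
  case (Suc j)
  then show ?thesis using dty_weaken[OF \<sigma> ok] i by (simp add: dsub_up_shift)
qed

lemma dty_dsub:
  "dty \<A> \<R> \<Gamma> M A \<Longrightarrow> dok \<A> \<R> \<Delta> \<Longrightarrow>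
    (\<And>i. i < length \<Gamma> \<Longrightarrow> dty \<A> \<R> \<Delta> (\<sigma> i) (dsub \<sigma> (lookup \<Gamma> i))) \<Longrightarrow>
    dty \<A> \<R> \<Delta> (dsub \<sigma> M) (dsub \<sigma> A)"
proof (induction arbitrary: \<Delta> \<sigma> rule: dok_dty.inducts(2)[where ?P1.0 = "\<lambda>_. True"])
  case (dty_Pi \<Gamma> A s1 B s2 s3)
  have A: "dty \<A> \<R> \<Delta> (dsub \<sigma> A) (DSort s1)"
    using dty_Pi.IH(1)[OF dty_Pi.prems] by simp
  then have ok: "dok \<A> \<R> (dsub \<sigma> A # \<Delta>)" by (rule dok_Cons[OF dty_Pi.prems(1)])
  have "dty \<A> \<R> (dsub \<sigma> A # \<Delta>) (dsub (up \<sigma>) B) (dsub (up \<sigma>) (DSort s2))"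
    by (rule dty_Pi.IH(2)[OF ok]) (rule dty_up[OF dty_Pi.prems(2) ok])
  then show ?case using A dty_Pi.hyps by (auto intro: dok_dty.dty_Pi)
next
  case (dty_Lam \<Gamma> A s1 M B s2 s3)
  have A: "dty \<A> \<R> \<Delta> (dsub \<sigma> A) (DSort s1)"
    using dty_Lam.IH(1)[OF dty_Lam.prems] by simp
  then have ok: "dok \<A> \<R> (dsub \<sigma> A # \<Delta>)" by (rule dok_Cons[OF dty_Lam.prems(1)])
  have "dty \<A> \<R> (dsub \<sigma> A # \<Delta>) (dsub (up \<sigma>) M) (dsub (up \<sigma>) B)"
    by (rule dty_Lam.IH(2)[OF ok]) (rule dty_up[OF dty_Lam.prems(2) ok])
  moreover have "dty \<A> \<R> (dsub \<sigma> A # \<Delta>) (dsub (up \<sigma>) B) (dsub (up \<sigma>) (DSort s2))"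
    by (rule dty_Lam.IH(3)[OF ok]) (rule dty_up[OF dty_Lam.prems(2) ok])
  ultimately show ?case using A dty_Lam.hyps by (auto intro: dok_dty.dty_Lam)
next
  case (dty_App \<Gamma> M A B N s)
  have "dty \<A> \<R> \<Delta> (dsub \<sigma> M) (dsub \<sigma> (DPi A B))" "dty \<A> \<R> \<Delta> (dsub \<sigma> N) (dsub \<sigma> A)"
    "dty \<A> \<R> \<Delta> (dsub \<sigma> A) (dsub \<sigma> (DSort s))"
    by (rule dty_App.IH[OF dty_App.prems]; assumption)+
  then show ?case by (auto simp: dsub_dinst intro: dok_dty.dty_App)
next
  case (dty_conv \<Gamma> M A B s)
  have "dty \<A> \<R> \<Delta> (dsub \<sigma> M) (dsub \<sigma> A)" "dty \<A> \<R> \<Delta> (dsub \<sigma> B) (dsub \<sigma> (DSort s))"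
    by (rule dty_conv.IH[OF dty_conv.prems]; assumption)+
  then show ?case using dty_conv.hyps by (auto intro: dok_dty.dty_conv dconv_dsub)
qed (auto intro: dok_dty.intros)

lemma dty_dinst:
  assumes M: "dty \<A> \<R> (A # \<Gamma>) M B" and N: "dty \<A> \<R> \<Gamma> N A"
  shows "dty \<A> \<R> \<Gamma> (dinst M N) (dinst B N)"
  unfolding dinst_def
proof (rule dty_dsub[OF M])
  show ok: "dok \<A> \<R> \<Gamma>" using N by (rule dty_imp_dok)
  fix i assume i: "i < length (A # \<Gamma>)"
  have "dsub (case_nat N DVar) (shift C) = C" for C
    using dinst_shift[of C N] by (simp add: dinst_def)
  then show "dty \<A> \<R> \<Gamma> (case_nat N DVar i) (dsub (case_nat N DVar) (lookup (A # \<Gamma>) i))"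
    using i N ok by (auto intro: dty_Var split: nat.split)
qed

section \<open>Generation, type correctness and subject reduction\<close>

lemma dty_DPiD:
  "dty \<A> \<R> \<Gamma> P C \<Longrightarrow> P = DPi A B \<Longrightarrow>
    \<exists>s1 s2. dty \<A> \<R> \<Gamma> A (DSort s1) \<and> dty \<A> \<R> (A # \<Gamma>) B (DSort s2)"
  by (induction rule: dok_dty.inducts(2)[where ?P1.0 = "\<lambda>_. True"]) auto

text \<open>Conversions at the end of the derivation accumulate in \<open>dconv (DPi A B) C\<close>;
  everything else stems from the last use of the abstraction rule.\<close>

lemma dty_DLamD:
  "dty \<A> \<R> \<Gamma> P C \<Longrightarrow> P = DLam A M \<Longrightarrow>
    \<exists>s1 s2 B. dty \<A> \<R> \<Gamma> A (DSort s1) \<and> dty \<A> \<R> (A # \<Gamma>) M B \<and> dty \<A> \<R> (A # \<Gamma>) B (DSort s2) \<and>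
      dconv (DPi A B) C"
proof (induction rule: dok_dty.inducts(2)[where ?P1.0 = "\<lambda>_. True"])
  case (dty_Lam \<Gamma> A' s1 M' B s2 s3)
  then show ?case using equivclp_refl[of dbeta "DPi A B"] by blast
next
  case (dty_conv \<Gamma> M A B s)
  then show ?case by (meson equivclp_trans)
qed auto

lemma dok_lookup: "dok \<A> \<R> \<Gamma> \<Longrightarrow> i < length \<Gamma> \<Longrightarrow> \<exists>s. dty \<A> \<R> \<Gamma> (lookup \<Gamma> i) (DSort s)"
proof (induction \<Gamma> arbitrary: i)
  case (Cons A \<Gamma>)
  from Cons.prems(1) obtain s where "dok \<A> \<R> \<Gamma>" "dty \<A> \<R> \<Gamma> A (DSort s)"
    by (auto elim: dok.cases)
  then show ?case
    using Cons dty_weaken[OF _ Cons.prems(1)] by (fastforce split: nat.split)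
qed simp

text \<open>A sort need not have a type in an arbitrary Pure Type System, hence the first
  alternative.\<close>

lemma dty_type_correct:
  "dty \<A> \<R> \<Gamma> M A \<Longrightarrow> (\<exists>s. A = DSort s) \<or> (\<exists>s. dty \<A> \<R> \<Gamma> A (DSort s))"
proof (induction rule: dok_dty.inducts(2)[where ?P1.0 = "\<lambda>_. True"])
  case (dty_App \<Gamma> M A B N s)
  then obtain s' where "dty \<A> \<R> \<Gamma> (DPi A B) (DSort s')" by auto
  then obtain s2 where "dty \<A> \<R> (A # \<Gamma>) B (DSort s2)" using dty_DPiD by blast
  from dty_dinst[OF this dty_App.hyps(2)] show ?case by (auto simp: dinst_def)
qed (auto intro: dok_lookup dok_dty.intros)

text \<open>Reducing the context and the term simultaneously is what makes the induction go through:
  a reduction in the domain of a binder changes the context in which its body is typed.\<close>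

lemma dsubject_reduction:
  "dok \<A> \<R> \<Gamma> \<Longrightarrow> dctx_step \<Gamma> \<Delta> \<Longrightarrow>
    dok \<A> \<R> \<Delta> \<and> (\<forall>i<length \<Gamma>. \<exists>s. dty \<A> \<R> \<Delta> (lookup \<Gamma> i) (DSort s))"
  "dty \<A> \<R> \<Gamma> M A \<Longrightarrow> dctx_step \<Gamma> \<Delta> \<Longrightarrow> dbeta_eq M N \<Longrightarrow> dty \<A> \<R> \<Delta> N A"
proof (induction arbitrary: \<Delta> and \<Delta> N rule: dok_dty.inducts)
  case (dok_Cons \<Gamma> A s)
  then obtain A' \<Delta>' where \<Delta>: "\<Delta> = A' # \<Delta>'" "dctx_step \<Gamma> \<Delta>'" "dbeta_eq A A'"
    by (auto simp: list_all2_Cons1)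
  have ok: "dok \<A> \<R> \<Delta>"
    unfolding \<Delta>(1) using dok_Cons(2)[OF \<Delta>(2)] dok_Cons(4)[OF \<Delta>(2,3)]
    by (blast intro: dok_dty.dok_Cons)
  \<comment> \<open>The second conjunct concerns the unreduced entries. For the new one the
    hypothesis is used with a reduced context but the trivial step on \<open>A\<close>.\<close>
  have "dty \<A> \<R> \<Delta>' A (DSort s)" by (rule dok_Cons(4)[OF \<Delta>(2) dbeta_eq_refl])
  then have "\<exists>s. dty \<A> \<R> \<Delta>' (case i of 0 \<Rightarrow> A | Suc j \<Rightarrow> lookup \<Gamma> j) (DSort s)"
    if "i < Suc (length \<Gamma>)" for i
    using dok_Cons(2)[OF \<Delta>(2)] that by (auto split: nat.split)
  then show ?case using ok dty_weaken[OF _ ok[unfolded \<Delta>(1)]] \<Delta>(1) by fastforce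
next
  case (dty_Sort \<Gamma> s1 s2)
  then show ?case by (auto simp: dbeta_eq_def elim: dbeta.cases intro: dok_dty.dty_Sort)
next
  case (dty_Var \<Gamma> i)
  have N: "N = DVar i" using dty_Var.prems(2) by (auto simp: dbeta_eq_def elim: dbeta.cases)
  have len: "i < length \<Delta>" using dty_Var(3) dty_Var.prems(1) by (simp add: list_all2_lengthD)
  \<comment> \<open>In \<Delta> the variable has the reduced type. The second conjunct types the
    original one there, which is what converting back to it requires.\<close>
  obtain s where "dok \<A> \<R> \<Delta>" "dty \<A> \<R> \<Delta> (lookup \<Gamma> i) (DSort s)"
    using dty_Var(2) dty_Var.prems dty_Var(3) by blast
  then show ?case unfolding N
    using lookup_dctx_step[OF dty_Var.prems(1) dty_Var(3)] len
    by (meson dty_conv dok_dty.dty_Var equivclp_sym)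
next
  case (dty_Pi \<Gamma> A s1 B s2 s3)
  obtain A' B' where N: "N = DPi A' B'" "dbeta_eq A A'" "dbeta_eq B B'"
    using dty_Pi.prems(2) by (auto simp: dbeta_eq_def elim: dbeta.cases)
  then show ?case using dty_Pi(2,4,5) dty_Pi.prems(1) by (auto intro!: dok_dty.dty_Pi)
next
  case (dty_Lam \<Gamma> A s1 M B s2 s3)
  obtain A' M' where N: "N = DLam A' M'" "dbeta_eq A A'" "dbeta_eq M M'"
    using dty_Lam.prems(2) by (auto simp: dbeta_eq_def elim: dbeta.cases)
  have step: "dctx_step (A # \<Gamma>) (C # \<Delta>)" if "dbeta_eq A C" for C
    using that dty_Lam.prems(1) by simp
  have "dty \<A> \<R> \<Delta> (DLam A' M') (DPi A' B)"
    using dty_Lam(2)[OF dty_Lam.prems(1) N(2)] dty_Lam(4)[OF step[OF N(2)] N(3)]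
      dty_Lam(6)[OF step[OF N(2)] dbeta_eq_refl] dty_Lam(7) by (blast intro: dok_dty.dty_Lam)
  \<comment> \<open>The rule now yields a product with domain \<open>A'\<close>. The original
    product is typed by the hypotheses with trivial steps on the terms, so conversion can restore
    it.\<close>
  moreover have "dty \<A> \<R> \<Delta> (DPi A B) (DSort s3)"
    using dty_Lam(2)[OF dty_Lam.prems(1) dbeta_eq_refl]
      dty_Lam(6)[OF step[OF dbeta_eq_refl] dbeta_eq_refl] dty_Lam(7)
    by (blast intro: dok_dty.dty_Pi)
  moreover have "dconv (DPi A' B) (DPi A B)"
    using N(2) by (auto simp: equivclp_refl intro!: dconv_DBind intro: dbeta_eq_dconv)
  ultimately show ?case unfolding N(1) by (rule dty_conv)
next
  case (dty_App \<Gamma> M A B P s)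
  have M: "dty \<A> \<R> \<Delta> M' (DPi A B)" if "dbeta_eq M M'" for M'
    using dty_App(2) dty_App.prems(1) that by blast
  have P: "dty \<A> \<R> \<Delta> P' A" if "dbeta_eq P P'" for P'
    using dty_App(4) dty_App.prems(1) that by blast
  have A: "dty \<A> \<R> \<Delta> A (DSort s)" by (rule dty_App(6)[OF dty_App.prems(1) dbeta_eq_refl])
  obtain s' where "dty \<A> \<R> \<Delta> (DPi A B) (DSort s')"
    using dty_type_correct[OF M[OF dbeta_eq_refl]] by auto
  then obtain s2 where B: "dty \<A> \<R> (A # \<Delta>) B (DSort s2)" using dty_DPiD by blast
  \<comment> \<open>Both cases below end with a conversion to \<open>dinst B P\<close>, so this type
    must have a sort even when \<open>P\<close> itself reduces.\<close>
  have BP: "dty \<A> \<R> \<Delta> (dinst B P) (DSort s2)"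
    using dty_dinst[OF B P[OF dbeta_eq_refl]] by (simp add: dinst_def)
  consider M' P' where "N = DApp M' P'" "dbeta_eq M M'" "dbeta_eq P P'"
    | A0 M0 where "M = DLam A0 M0" "N = dinst M0 P"
    using dty_App.prems(2) by (auto simp: dbeta_eq_def elim: dbeta.cases)
  then show ?case
  proof cases
    case 1
    have "dconv (dinst B P') (dinst B P)"
      using 1(3) by (auto simp: equivclp_refl intro!: dconv_dinst intro: dbeta_eq_dconv)
    then show ?thesis unfolding 1(1)
      using dok_dty.dty_App[OF M[OF 1(2)] P[OF 1(3)] A] BP by (blast intro: dty_conv)
  next
    case 2
    obtain s0 B0 where inv: "dty \<A> \<R> \<Delta> A0 (DSort s0)" "dty \<A> \<R> (A0 # \<Delta>) M0 B0"
      "dconv (DPi A0 B0) (DPi A B)"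
      using dty_DLamD[OF M[OF dbeta_eq_refl] 2(1)] by blast
    \<comment> \<open>Injectivity of products makes \<open>A\<close> and \<open>A0\<close>
      convertible, and generation has typed \<open>A0\<close>, so the argument can be moved to the
      domain of the abstraction.\<close>
    have "dty \<A> \<R> \<Delta> P A0"
      using dconv_DBind_inj(1)[OF inv(3)] P[OF dbeta_eq_refl] inv(1) by (blast intro: dty_conv equivclp_sym)
    with inv(2) have "dty \<A> \<R> \<Delta> N (dinst B0 P)" unfolding 2(2) by (rule dty_dinst)
    moreover have "dconv (dinst B0 P) (dinst B P)"
      using dconv_DBind_inj(2)[OF inv(3)] by (auto simp: equivclp_refl intro: dconv_dinst)
    ultimately show ?thesis using BP by (blast intro: dty_conv)
  qed
next
  case (dty_conv \<Gamma> M A B s)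
  then show ?case by (blast intro: dok_dty.dty_conv dbeta_eq_refl)
qed (auto intro: dok_dty.intros)

end

section \<open>Translation of named terms\<close>

definition lift_env :: "'v \<Rightarrow> ('v \<Rightarrow> 's dtrm) \<Rightarrow> 'v \<Rightarrow> 's dtrm" where
  "lift_env x \<theta> = (\<lambda>y. if y = x then DVar 0 else shift (\<theta> y))"

abbreviation dvars :: "('v \<Rightarrow> nat) \<Rightarrow> 'v \<Rightarrow> 's dtrm" where
  "dvars e \<equiv> (\<lambda>x. DVar (e x))"

text \<open>Environments have terms, not indices, as values: they can then absorb a named
  substitution, as in \<open>trs_subst\<close>.\<close>

primrec trs :: "('s, 'v) trm \<Rightarrow> ('v \<Rightarrow> 's dtrm) \<Rightarrow> 's dtrm" where
  "trs (Sort s) \<theta> = DSort s"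
| "trs (Var x) \<theta> = \<theta> x"
| "trs (Lam x A M) \<theta> = DLam (trs A \<theta>) (trs M (lift_env x \<theta>))"
| "trs (Prod x A M) \<theta> = DPi (trs A \<theta>) (trs M (lift_env x \<theta>))"
| "trs (App M N) \<theta> = DApp (trs M \<theta>) (trs N \<theta>)"

lemma ex_fresh: "finite S \<Longrightarrow> \<exists>n. (var_enum n :: 'v::enumerated_var) \<notin> S"
proof (rule ccontr)
  assume S: "finite S" and "\<nexists>n. (var_enum n :: 'v) \<notin> S"
  then have "range (var_enum :: nat \<Rightarrow> 'v) \<subseteq> S" by auto
  with S have "finite (range (var_enum :: nat \<Rightarrow> 'v))" by (rule rev_finite_subset)
  then have "finite (UNIV :: nat set)" by (rule finite_imageD[OF _ bij_is_inj[OF bij_var_enum]])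
  then show False by simp
qed

lemma fresh_var_fresh:
  assumes "z \<in> set xs"
  shows "fresh_var \<sigma> xs \<notin> set (fv (\<sigma> z))"
proof -
  have "\<exists>n. \<forall>z\<in>set xs. var_enum n \<notin> set (fv (\<sigma> z))"
    using ex_fresh[of "\<Union>z\<in>set xs. set (fv (\<sigma> z))"] by auto
  from LeastI_ex[OF this] assms show ?thesis by (simp add: fresh_var_def)
qed

lemma trs_cong: "(\<And>x. x \<in> set (fv M) \<Longrightarrow> \<theta> x = \<theta>' x) \<Longrightarrow> trs M \<theta> = trs M \<theta>'"
proof (induction M arbitrary: \<theta> \<theta>')
  case (Lam x A M)
  have "trs A \<theta> = trs A \<theta>'" "trs M (lift_env x \<theta>) = trs M (lift_env x \<theta>')"
    by (rule Lam.IH; simp add: Lam.prems lift_env_def)+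
  then show ?case by simp
next
  case (Prod x A M)
  have "trs A \<theta> = trs A \<theta>'" "trs M (lift_env x \<theta>) = trs M (lift_env x \<theta>')"
    by (rule Prod.IH; simp add: Prod.prems lift_env_def)+
  then show ?case by simp
next
  case (App M N)
  have "trs M \<theta> = trs M \<theta>'" "trs N \<theta> = trs N \<theta>'"
    by (rule App.IH; simp add: App.prems)+
  then show ?case by simp
qed simp_all

lemma dsub_lift_env:
  "(\<lambda>y. dsub (up \<tau>) (lift_env x \<theta> y)) = lift_env x (\<lambda>y. dsub \<tau> (\<theta> y))"
  by (rule ext) (simp add: lift_env_def dsub_up_shift)

lemma dsub_trs: "dsub \<tau> (trs M \<theta>) = trs M (\<lambda>x. dsub \<tau> (\<theta> x))"
  by (induction M arbitrary: \<tau> \<theta>) (simp_all add: dsub_lift_env)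

lemma dfv_lift_env:
  "{i. Suc i \<in> (\<Union>y\<in>S. dfv (lift_env x \<theta> y))} = (\<Union>y\<in>S - {x}. dfv (\<theta> y))"
  by (auto simp: lift_env_def dfv_dren split: if_splits)

lemma dfv_trs: "dfv (trs M \<theta>) = (\<Union>x\<in>set (fv M). dfv (\<theta> x))"
proof (induction M arbitrary: \<theta>)
  case (Lam x A M)
  show ?case by (simp only: trs.simps dfv.simps Lam.IH dfv_lift_env) auto
next
  case (Prod x A M)
  show ?case by (simp only: trs.simps dfv.simps Prod.IH dfv_lift_env) auto
qed auto

lemma trs_lift_env_fresh: "x \<notin> set (fv M) \<Longrightarrow> trs M (lift_env x \<theta>) = shift (trs M \<theta>)"
  by (auto simp: dren_eq_dsub dsub_trs lift_env_def intro!: trs_cong)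

text \<open>The binder step of \<open>trs_subst\<close>, with the induction hypothesis as an
  assumption. It serves both binders and, since any sufficiently fresh \<open>y\<close> is allowed,
  also \<open>trs_subst1_Var\<close>.\<close>

lemma trs_subst_lift_env:
  assumes IH: "\<And>\<sigma> \<theta>. trs (M \<bullet> \<sigma>) \<theta> = trs M (\<lambda>z. trs (\<sigma> z) \<theta>)"
    and y: "\<And>z. z \<in> set (fv M) \<Longrightarrow> z \<noteq> x \<Longrightarrow> y \<notin> set (fv (\<sigma> z))"
  shows "trs (M \<bullet> \<sigma>(x := Var y)) (lift_env y \<theta>) = trs M (lift_env x (\<lambda>z. trs (\<sigma> z) \<theta>))"
  unfolding IH
proof (rule trs_cong)
  fix z assume "z \<in> set (fv M)"
  then show "trs ((\<sigma>(x := Var y)) z) (lift_env y \<theta>) = lift_env x (\<lambda>z. trs (\<sigma> z) \<theta>) z"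
    using y by (cases "z = x") (simp_all add: trs_lift_env_fresh, simp_all add: lift_env_def)
qed

lemma trs_subst: "trs (M \<bullet> \<sigma>) \<theta> = trs M (\<lambda>x. trs (\<sigma> x) \<theta>)"
proof (induction M arbitrary: \<sigma> \<theta>)
  case (Lam x A M)
  show ?case
    by (simp add: Let_def Lam.IH(1) trs_subst_lift_env[OF Lam.IH(2)] fresh_var_fresh)
next
  case (Prod x A M)
  show ?case
    by (simp add: Let_def Prod.IH(1) trs_subst_lift_env[OF Prod.IH(2)] fresh_var_fresh)
qed simp_all

lemma trs_subst1: "trs (M[x ::= N]) \<theta> = dinst (trs M (lift_env x \<theta>)) (trs N \<theta>)"
proof -
  have "(\<lambda>z. trs ((Var(x := N)) z) \<theta>) = (\<lambda>z. dinst (lift_env x \<theta> z) (trs N \<theta>))"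
    by (rule ext) (simp add: lift_env_def, simp add: dinst_def)
  then show ?thesis by (simp add: subst1_def trs_subst dinst_def dsub_trs)
qed

lemma trs_subst1_Var:
  "y \<notin> set (removeAll x (fv M)) \<Longrightarrow> trs (M[x ::= Var y]) (lift_env y \<theta>) = trs M (lift_env x \<theta>)"
  unfolding subst1_def by (subst trs_subst_lift_env) (auto simp: trs_subst)

lemma lift_env_dvars: "lift_env x (dvars e) = dvars (\<lambda>y. if y = x then 0 else Suc (e y))"
  by (rule ext) (simp add: lift_env_def)

subsection \<open>Canonical representatives\<close>

primrec named_bind :: "quant \<Rightarrow> 'v \<Rightarrow> ('s, 'v) trm \<Rightarrow> ('s, 'v) trm \<Rightarrow> ('s, 'v) trm" where
  "named_bind QLam = Lam"
| "named_bind QPi = Prod"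

text \<open>The bound variables are chosen exactly as in Stoughton's substitution, so that \<open>M \<bullet> \<sigma>\<close>
  depends only on the de Bruijn translation of \<open>M\<close>.\<close>

primrec named :: "'s dtrm \<Rightarrow> (nat \<Rightarrow> ('s, 'v::enumerated_var) trm) \<Rightarrow> ('s, 'v) trm" where
  "named (DSort s) \<rho> = Sort s"
| "named (DVar i) \<rho> = \<rho> i"
| "named (DBind q A M) \<rho> =
    (let y = var_enum (LEAST n. \<forall>i. Suc i \<in> dfv M \<longrightarrow> var_enum n \<notin> set (fv (\<rho> i)))
     in named_bind q y (named A \<rho>) (named M (case_nat (Var y) \<rho>)))"
| "named (DApp M N) \<rho> = App (named M \<rho>) (named N \<rho>)"

text \<open>The free indices \<open>Suc i\<close> of the translated body come from its free
  variables other than \<open>x\<close>, and there \<rho> carries the same terms as \<sigma>. Both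
  searches therefore avoid the same names.\<close>

lemma fresh_var_eq:
  assumes "\<And>z. z \<in> set (fv M) \<Longrightarrow> z \<noteq> x \<Longrightarrow> \<sigma> z = \<rho> (e z)"
  shows "fresh_var \<sigma> (removeAll x (fv M)) =
    var_enum (LEAST n. \<forall>i. Suc i \<in> dfv (trs M (lift_env x (dvars e))) \<longrightarrow> var_enum n \<notin> set (fv (\<rho> i)))"
proof -
  have "Suc i \<in> dfv (trs M (lift_env x (dvars e))) \<longleftrightarrow> (\<exists>z\<in>set (fv M) - {x}. i = e z)" for i
    using dfv_lift_env[where S = "set (fv M)" and x = x and \<theta> = "dvars e"] by (auto simp: dfv_trs set_eq_iff)
  then have "(\<forall>z\<in>set (removeAll x (fv M)). var_enum n \<notin> set (fv (\<sigma> z))) \<longleftrightarrow>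
      (\<forall>i. Suc i \<in> dfv (trs M (lift_env x (dvars e))) \<longrightarrow> var_enum n \<notin> set (fv (\<rho> i)))" for n
    using assms by auto
  then show ?thesis by (simp only: fresh_var_def)
qed

text \<open>The right-hand side sees \<open>M\<close> only through its translation; this is where
  syntactic equality of substituted \<alpha>-variants comes from. That \<sigma> factors through
  \<open>e\<close> on the free variables is preserved under binders, where index 0 is sent to the
  new name.\<close>

lemma subst_eq_named:
  "(\<And>x. x \<in> set (fv M) \<Longrightarrow> \<sigma> x = \<rho> (e x)) \<Longrightarrow> M \<bullet> \<sigma> = named (trs M (dvars e)) \<rho>"
proof (induction M arbitrary: \<sigma> \<rho> e)
  case (Lam x A M)
  define y where "y = fresh_var \<sigma> (removeAll x (fv M))"
  have y: "y = var_enum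
      (LEAST n. \<forall>i. Suc i \<in> dfv (trs M (lift_env x (dvars e))) \<longrightarrow> var_enum n \<notin> set (fv (\<rho> i)))"
    unfolding y_def by (rule fresh_var_eq) (simp add: Lam.prems)
  have "A \<bullet> \<sigma> = named (trs A (dvars e)) \<rho>" by (rule Lam.IH) (simp add: Lam.prems)
  moreover have "M \<bullet> \<sigma>(x := Var y) = named (trs M (lift_env x (dvars e))) (case_nat (Var y) \<rho>)"
    unfolding lift_env_dvars by (rule Lam.IH) (simp add: Lam.prems)
  ultimately show ?case by (simp add: Let_def y_def[symmetric]) (metis y)
next
  case (Prod x A M)
  define y where "y = fresh_var \<sigma> (removeAll x (fv M))"
  have y: "y = var_enum
      (LEAST n. \<forall>i. Suc i \<in> dfv (trs M (lift_env x (dvars e))) \<longrightarrow> var_enum n \<notin> set (fv (\<rho> i)))"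
    unfolding y_def by (rule fresh_var_eq) (simp add: Prod.prems)
  have "A \<bullet> \<sigma> = named (trs A (dvars e)) \<rho>" by (rule Prod.IH) (simp add: Prod.prems)
  moreover have "M \<bullet> \<sigma>(x := Var y) = named (trs M (lift_env x (dvars e))) (case_nat (Var y) \<rho>)"
    unfolding lift_env_dvars by (rule Prod.IH) (simp add: Prod.prems)
  ultimately show ?case by (simp add: Let_def y_def[symmetric]) (metis y)
next
  case (App M N)
  have "M \<bullet> \<sigma> = named (trs M (dvars e)) \<rho>" "N \<bullet> \<sigma> = named (trs N (dvars e)) \<rho>"
    by (rule App.IH; simp add: App.prems)+
  then show ?case by simp
qed simp_all

lemma finite_dfv: "finite (dfv M)"
proof (induction M)
  case (DBind q A M)
  then show ?case by (simp add: finite_vimageI[of "dfv M" Suc, unfolded vimage_def])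
qed simp_all

text \<open>Shows that \<open>named\<close> yields representatives; the conversion rule needs one
  for a type that no named term has supplied yet.\<close>

lemma trs_named:
  fixes \<rho> :: "nat \<Rightarrow> ('s, 'v::enumerated_var) trm"
  shows "trs (named M \<rho>) \<theta> = dsub (\<lambda>i. trs (\<rho> i) \<theta>) M"
proof (induction M arbitrary: \<rho> \<theta>)
  case (DBind q A M \<rho> \<theta>)
  define P where "P n \<longleftrightarrow> (\<forall>i. Suc i \<in> dfv M \<longrightarrow> (var_enum n :: 'v) \<notin> set (fv (\<rho> i)))" for n
  have "finite {i. Suc i \<in> dfv M}"
    using finite_vimageI[OF finite_dfv[of M], of Suc] by (simp add: vimage_def)
  then have "finite (\<Union>i\<in>{i. Suc i \<in> dfv M}. set (fv (\<rho> i)))" by simp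
  from ex_fresh[OF this] have "\<exists>n. P n" by (auto simp: P_def)
  then have P: "P (Least P)" by (rule LeastI_ex)
  define y :: 'v where "y = var_enum (Least P)"
  have "trs (named M (case_nat (Var y) \<rho>)) (lift_env y \<theta>) =
      dsub (\<lambda>i. trs (case_nat (Var y) \<rho> i) (lift_env y \<theta>)) M"
    by (rule DBind.IH)
  also have "\<dots> = dsub (up (\<lambda>i. trs (\<rho> i) \<theta>)) M"
  proof (rule dsub_cong)
    fix i assume "i \<in> dfv M"
    then show "trs (case_nat (Var y) \<rho> i) (lift_env y \<theta>) = up (\<lambda>i. trs (\<rho> i) \<theta>) i"
      using P by (cases i) (simp_all add: P_def y_def trs_lift_env_fresh, simp_all add: lift_env_def)
  qed
  finally have "trs (named M (case_nat (Var y) \<rho>)) (lift_env y \<theta>) = dsub (up (\<lambda>i. trs (\<rho> i) \<theta>)) M" .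
  moreover have "named (DBind q A M) \<rho> = named_bind q y (named A \<rho>) (named M (case_nat (Var y) \<rho>))"
    by (simp add: Let_def y_def P_def[abs_def])
  ultimately show ?case by (cases q) (simp_all add: DBind.IH)
qed simp_all

subsection \<open>Conversion and reduction\<close>

lemma alpha_trs: "M \<sim>\<alpha> N \<Longrightarrow> trs M \<theta> = trs N \<theta>"
proof (induction arbitrary: \<theta> rule: alpha.induct)
  case (alpha_Lam A A' M x y M' x')
  then have "trs M (lift_env x \<theta>) = trs M' (lift_env x' \<theta>)" by (metis trs_subst1_Var)
  then show ?case by (simp add: alpha_Lam.IH)
next
  case (alpha_Prod A A' M x y M' x')
  then have "trs M (lift_env x \<theta>) = trs M' (lift_env x' \<theta>)" by (metis trs_subst1_Var)
  then show ?case by (simp add: alpha_Prod.IH)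
qed simp_all

lemma subst1_eq_of_trs_eq:
  fixes M M' :: "('s, 'v::enumerated_var) trm"
  assumes inj: "inj e" and eq: "trs M (lift_env x (dvars e)) = trs M' (lift_env x' (dvars e))"
  shows "M[x ::= Var y] = M'[x' ::= Var y]"
proof -
  \<comment> \<open>Index 0 is the bound variable, to be replaced by \<open>y\<close>; at the other
    indices \<open>inv e\<close> recovers the original names, as \<open>e\<close> is
    injective.\<close>
  define \<rho> :: "nat \<Rightarrow> ('s, 'v) trm" where "\<rho> = case_nat (Var y) (\<lambda>n. Var (inv e n))"
  have "N[z ::= Var y] = named (trs N (lift_env z (dvars e))) \<rho>" for N :: "('s, 'v) trm" and z
    unfolding subst1_def lift_env_dvars by (rule subst_eq_named) (auto simp: \<rho>_def inj)
  from this[of M x] this[of M' x'] show ?thesis by (simp only: eq)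
qed

text \<open>For binders \<alpha>-conversion asks for bodies that agree syntactically after
  substitution. That is \<open>subst1_eq_of_trs_eq\<close>, so the induction hypothesis serves only
  the domain.\<close>

lemma trs_eq_imp_alpha:
  "trs M (dvars e) = trs N (dvars e) \<Longrightarrow> inj e \<Longrightarrow> M \<sim>\<alpha> N"
proof (induction M arbitrary: N)
  case (Sort s)
  then show ?case by (cases N) (auto intro: alpha.intros)
next
  case (Var x)
  then show ?case by (cases N) (auto simp: inj_def intro: alpha.intros)
next
  case (Lam x A M)
  then obtain x' A' M' where N: "N = Lam x' A' M'" by (cases N) auto
  obtain n where "var_enum n \<notin> set (fv M) \<union> set (fv M')"
    using ex_fresh[of "set (fv M) \<union> set (fv M')"] by auto
  moreover have "M[x ::= Var y] = M'[x' ::= Var y]" for y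
    using Lam.prems unfolding N by (intro subst1_eq_of_trs_eq) auto
  ultimately show ?case using Lam unfolding N by (auto intro!: alpha_Lam)
next
  case (Prod x A M)
  then obtain x' A' M' where N: "N = Prod x' A' M'" by (cases N) auto
  obtain n where "var_enum n \<notin> set (fv M) \<union> set (fv M')"
    using ex_fresh[of "set (fv M) \<union> set (fv M')"] by auto
  moreover have "M[x ::= Var y] = M'[x' ::= Var y]" for y
    using Prod.prems unfolding N by (intro subst1_eq_of_trs_eq) auto
  ultimately show ?case using Prod unfolding N by (auto intro!: alpha_Prod)
next
  case (App M1 M2)
  then show ?case by (cases N) (auto intro: alpha.intros)
qed

lemma beta_trs: "M \<rightarrow>\<beta> N \<Longrightarrow> dbeta (trs M \<theta>) (trs N \<theta>)"
  by (induction arbitrary: \<theta> rule: beta.induct) (auto simp: trs_subst1 intro: dbeta.intros)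

text \<open>With variables as values the environment creates no redexes, so each redex of the
  translation sits over a redex of \<open>M\<close>.\<close>

lemma dbeta_trs_lift:
  "dbeta (trs M (dvars e)) n \<Longrightarrow> \<exists>N. M \<rightarrow>\<beta> N \<and> trs N (dvars e) = n"
proof (induction M arbitrary: e n)
  case (Lam x A M)
  from Lam.prems consider a where "dbeta (trs A (dvars e)) a" "n = DLam a (trs M (lift_env x (dvars e)))"
    | m where "dbeta (trs M (lift_env x (dvars e))) m" "n = DLam (trs A (dvars e)) m"
    by (auto elim: dbeta.cases)
  then show ?case
  proof cases
    case 1
    then show ?thesis using Lam.IH(1)[OF 1(1)] by (metis beta_LamL trs.simps(3))
  next
    case 2
    then obtain N where "M \<rightarrow>\<beta> N" "trs N (lift_env x (dvars e)) = m"
      using Lam.IH(2)[of "\<lambda>y. if y = x then 0 else Suc (e y)" m] by (auto simp: lift_env_dvars)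
    then show ?thesis using 2(2) by (intro exI[of _ "Lam x A N"]) (auto intro: beta_LamR)
  qed
next
  case (Prod x A M)
  from Prod.prems consider a where "dbeta (trs A (dvars e)) a" "n = DPi a (trs M (lift_env x (dvars e)))"
    | m where "dbeta (trs M (lift_env x (dvars e))) m" "n = DPi (trs A (dvars e)) m"
    by (auto elim: dbeta.cases)
  then show ?case
  proof cases
    case 1
    then show ?thesis using Prod.IH(1)[OF 1(1)] by (metis beta_ProdL trs.simps(4))
  next
    case 2
    then obtain N where "M \<rightarrow>\<beta> N" "trs N (lift_env x (dvars e)) = m"
      using Prod.IH(2)[of "\<lambda>y. if y = x then 0 else Suc (e y)" m] by (auto simp: lift_env_dvars)
    then show ?thesis using 2(2) by (intro exI[of _ "Prod x A N"]) (auto intro: beta_ProdR)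
  qed
next
  case (App P Q)
  from App.prems consider p where "dbeta (trs P (dvars e)) p" "n = DApp p (trs Q (dvars e))"
    | q where "dbeta (trs Q (dvars e)) q" "n = DApp (trs P (dvars e)) q"
    | a m where "trs P (dvars e) = DLam a m" "n = dinst m (trs Q (dvars e))"
    by (auto elim: dbeta.cases)
  then show ?case
  proof cases
    case 1
    then show ?thesis using App.IH(1)[OF 1(1)] by (metis beta_AppL trs.simps(5))
  next
    case 2
    then show ?thesis using App.IH(2)[OF 2(1)] by (metis beta_AppR trs.simps(5))
  next
    case 3
    then obtain x A M where P: "P = Lam x A M" by (cases P) auto
    with 3 have "trs (M[x ::= Q]) (dvars e) = n" by (simp add: trs_subst1)
    then show ?thesis unfolding P by (blast intro: beta_redex)
  qed
qed (auto elim: dbeta.cases)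

lemma beta_conv_trs: "M \<simeq>\<beta> N \<Longrightarrow> dconv (trs M \<theta>) (trs N \<theta>)"
  unfolding beta_conv_def
proof (induction rule: equivclp_induct)
  case (step N P)
  then have "dconv (trs N \<theta>) (trs P \<theta>)"
    by (auto dest!: alpha_trs[of _ _ \<theta>] beta_trs[of _ _ \<theta>] simp: equivclp_refl intro: equivclp_sym)
  with step.IH show ?case by (rule equivclp_trans)
qed (simp add: equivclp_refl)

lemma alpha_imp_beta_conv: "M \<sim>\<alpha> N \<Longrightarrow> M \<simeq>\<beta> N"
  and beta_imp_beta_conv: "M \<rightarrow>\<beta> N \<Longrightarrow> M \<simeq>\<beta> N"
  and beta_conv_refl: "M \<simeq>\<beta> M"
  and beta_conv_sym: "M \<simeq>\<beta> N \<Longrightarrow> N \<simeq>\<beta> M"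
  and beta_conv_trans: "M \<simeq>\<beta> N \<Longrightarrow> N \<simeq>\<beta> P \<Longrightarrow> M \<simeq>\<beta> P"
  by (auto simp: beta_conv_def equivclp_refl intro: equivclp_sym equivclp_trans)

lemma rtranclp_dbeta_trs_lift:
  "dbeta\<^sup>*\<^sup>* (trs M (dvars e)) n \<Longrightarrow> \<exists>N. M \<simeq>\<beta> N \<and> trs N (dvars e) = n"
proof (induction rule: rtranclp_induct)
  case base
  show ?case using beta_conv_refl by blast
next
  case (step n p)
  then obtain N P where "M \<simeq>\<beta> N" "N \<rightarrow>\<beta> P" "trs P (dvars e) = p"
    using dbeta_trs_lift by blast
  then show ?case by (blast intro: beta_conv_trans beta_imp_beta_conv)
qed

text \<open>Only reductions are lifted, never expansions: by Church-Rosser both sides reduce to a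
  common term, and its two liftings are \<alpha>-convertible.\<close>

lemma dconv_imp_beta_conv:
  assumes "dconv (trs M (dvars e)) (trs N (dvars e))" "inj e"
  shows "M \<simeq>\<beta> N"
proof -
  obtain M' N' where "M \<simeq>\<beta> M'" "N \<simeq>\<beta> N'" "trs M' (dvars e) = trs N' (dvars e)"
    using dconv_joinable[OF assms(1)] rtranclp_dbeta_trs_lift by metis
  moreover from this have "M' \<simeq>\<beta> N'"
    using assms(2) by (blast intro: alpha_imp_beta_conv trs_eq_imp_alpha)
  ultimately show ?thesis by (meson beta_conv_sym beta_conv_trans)
qed

section \<open>Equivalence of the typing judgments\<close>

text \<open>Variables outside the context are numbered after it, by their place in the enumeration.
  This keeps \<open>env\<close> injective on all variables, so \<alpha>-conversion can be read off
  translations.\<close>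

primrec env :: "('s, 'v::enumerated_var) ctx \<Rightarrow> 'v \<Rightarrow> nat" where
  "env [] = inv var_enum"
| "env (p # \<Gamma>) = (\<lambda>y. if y = fst p then 0 else Suc (env \<Gamma> y))"

abbreviation tr :: "('s, 'v::enumerated_var) ctx \<Rightarrow> ('s, 'v) trm \<Rightarrow> 's dtrm" where
  "tr \<Gamma> M \<equiv> trs M (dvars (env \<Gamma>))"

primrec dctx :: "('s, 'v::enumerated_var) ctx \<Rightarrow> 's dtrm list" where
  "dctx [] = []"
| "dctx (p # \<Gamma>) = tr \<Gamma> (snd p) # dctx \<Gamma>"

lemma length_dctx [simp]: "length (dctx \<Gamma>) = length \<Gamma>"
  by (induction \<Gamma>) auto

lemma inj_env: "inj (env \<Gamma>)"
proof (induction \<Gamma>)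
  case Nil
  then show ?case using bij_is_inj[OF bij_imp_bij_inv[OF bij_var_enum]] by simp
next
  case (Cons p \<Gamma>)
  then show ?case by (auto simp: inj_def)
qed

lemma env_less_iff: "env \<Gamma> x < length \<Gamma> \<longleftrightarrow> x \<in> set (ctx_dom \<Gamma>)"
  by (induction \<Gamma>) auto

lemma env_nth: "distinct (ctx_dom \<Gamma>) \<Longrightarrow> i < length \<Gamma> \<Longrightarrow> env \<Gamma> (ctx_dom \<Gamma> ! i) = i"
proof (induction \<Gamma> arbitrary: i)
  case (Cons p \<Gamma>)
  have "fst (\<Gamma> ! j) \<noteq> fst p" if "j < length \<Gamma>" for j
    using Cons.prems(1) nth_mem[OF that] by (metis distinct.simps(2) image_eqI list.set_map list.simps(9))
  then show ?case using Cons by (cases i) auto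
qed simp

lemma env_cong: "ctx_dom \<Gamma> = ctx_dom \<Delta> \<Longrightarrow> env \<Gamma> = env \<Delta>"
proof (induction \<Gamma> arbitrary: \<Delta>)
  case (Cons p \<Gamma>)
  then show ?case by (cases \<Delta>) auto
qed auto

lemma tr_Cons: "trs M (dvars (env ((x, A) # \<Gamma>))) = trs M (lift_env x (dvars (env \<Gamma>)))"
  by (simp add: lift_env_dvars)

lemma tr_subst1_Cons:
  "y \<notin> set (removeAll x (fv M)) \<Longrightarrow>
    tr ((y, A) # \<Gamma>) (M[x ::= Var y]) = trs M (lift_env x (dvars (env \<Gamma>)))"
  unfolding tr_Cons by (rule trs_subst1_Var)

lemma fv_subset_ctx_dom:
  "dfv (tr \<Gamma> M) \<subseteq> {..<length \<Gamma>} \<Longrightarrow> set (fv M) \<subseteq> set (ctx_dom \<Gamma>)"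
  by (auto simp: dfv_trs env_less_iff[symmetric] simp del: set_map)

context
  fixes \<A> :: "'s \<Rightarrow> 's \<Rightarrow> bool" and \<R> :: "'s \<Rightarrow> 's \<Rightarrow> 's \<Rightarrow> bool"
begin

text \<open>The context part is strengthened for the variable rule. Scoping of the entries ensures
  that extending the context by a fresh variable merely shifts their translations, in step with
  \<open>lookup\<close>.\<close>

lemma typing_imp_dty:
  fixes \<Gamma> :: "('s, 'v::enumerated_var) ctx"
  shows "ctx_ok \<A> \<R> \<Gamma> \<Longrightarrow> dok \<A> \<R> (dctx \<Gamma>) \<and> distinct (ctx_dom \<Gamma>) \<and>
      (\<forall>(x, A) \<in> set \<Gamma>. set (fv A) \<subseteq> set (ctx_dom \<Gamma>) \<and> lookup (dctx \<Gamma>) (env \<Gamma> x) = tr \<Gamma> A)"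
    and "typing \<A> \<R> \<Gamma> M A \<Longrightarrow> dty \<A> \<R> (dctx \<Gamma>) (tr \<Gamma> M) (tr \<Gamma> A)"
proof (induction rule: ctx_ok_typing.inducts)
  case (ok_Cons \<Gamma> A s x)
  have A: "dty \<A> \<R> (dctx \<Gamma>) (tr \<Gamma> A) (DSort s)" using ok_Cons(4) by simp
  then have fvA: "set (fv A) \<subseteq> set (ctx_dom \<Gamma>)"
    by (intro fv_subset_ctx_dom) (use dty_dfv in fastforce)
  have "set (fv B) \<subseteq> set (ctx_dom ((x, A) # \<Gamma>)) \<and>
      lookup (dctx ((x, A) # \<Gamma>)) (env ((x, A) # \<Gamma>) y) = tr ((x, A) # \<Gamma>) B"
    if yB: "(y, B) \<in> set ((x, A) # \<Gamma>)" for y B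
  proof -
    have fvB: "set (fv B) \<subseteq> set (ctx_dom \<Gamma>)" using yB fvA ok_Cons(2) by auto
    then have "tr ((x, A) # \<Gamma>) B = shift (tr \<Gamma> B)"
      unfolding tr_Cons using ok_Cons(5) by (intro trs_lift_env_fresh) auto
    moreover have "y \<noteq> x" if "(y, B) \<in> set \<Gamma>" using that ok_Cons(5) by force
    ultimately have "lookup (dctx ((x, A) # \<Gamma>)) (env ((x, A) # \<Gamma>) y) = tr ((x, A) # \<Gamma>) B"
      using yB ok_Cons(2) by (auto simp del: trs.simps)
    then show ?thesis using fvB by auto
  qed
  moreover have "dok \<A> \<R> (dctx ((x, A) # \<Gamma>))" using ok_Cons(2) A by (auto intro: dok_Cons)
  moreover have "distinct (ctx_dom ((x, A) # \<Gamma>))" using ok_Cons(2,5) by simp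
  ultimately show ?case by blast
next
  case (ty_sort \<Gamma> s1 s2)
  then show ?case by (auto intro: dty_Sort)
next
  case (ty_var \<Gamma> x A)
  then have "env \<Gamma> x < length (dctx \<Gamma>)" by (force simp: env_less_iff)
  moreover have "lookup (dctx \<Gamma>) (env \<Gamma> x) = tr \<Gamma> A" using ty_var by auto
  ultimately show ?case using ty_var dty_Var[of \<A> \<R> "dctx \<Gamma>" "env \<Gamma> x"] by simp
next
  case (ty_prod \<Gamma> A s1 y B x s2 s3)
  then show ?case by (auto simp: tr_subst1_Cons simp del: env.simps intro: dty_Pi)
next
  case (ty_abs \<Gamma> A s1 z M x B y s2 s3)
  then show ?case by (auto simp: tr_subst1_Cons simp del: env.simps intro: dty_Lam)
next
  case (ty_app \<Gamma> M x A B N)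
  have M: "dty \<A> \<R> (dctx \<Gamma>) (tr \<Gamma> M) (DPi (tr \<Gamma> A) (trs B (lift_env x (dvars (env \<Gamma>)))))"
    using ty_app(2) by simp
  \<comment> \<open>This supplies the additional premise of \<open>dty_App\<close>: a product is not
    a sort, so type correctness gives it one.\<close>
  then obtain s where "dty \<A> \<R> (dctx \<Gamma>) (tr \<Gamma> A) (DSort s)"
    using dty_type_correct[OF M] dty_DPiD by blast
  then show ?case using M ty_app(4) by (auto simp: trs_subst1 intro: dty_App)
next
  case (ty_conv \<Gamma> M A B s)
  then show ?case using beta_conv_trs by (auto intro: dty_conv)
qed (auto intro: dok_Nil)

lemma dctx_ConsE:
  assumes "dctx \<Gamma> = A # D"
  obtains x A' \<Gamma>' where "\<Gamma> = (x, A') # \<Gamma>'" "A = tr \<Gamma>' A'" "D = dctx \<Gamma>'"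
  using assms by (cases \<Gamma>) auto

lemma trs_eq_DBindE:
  assumes "trs M (dvars e) = DBind q A B"
  obtains x A' B' where "M = named_bind q x A' B'" "trs A' (dvars e) = A"
    "trs B' (lift_env x (dvars e)) = B"
  using assms by (cases M) auto

lemma trs_eq_DSort: "trs M (dvars e) = DSort s \<Longrightarrow> M = Sort s"
  by (cases M) auto

lemma fresh_ctxE:
  fixes \<Gamma> :: "('s, 'v::enumerated_var) ctx"
  obtains z where "z \<notin> set (ctx_dom \<Gamma>)" "z \<notin> set (fv (M :: ('s, 'v) trm))"
  using ex_fresh[of "set (ctx_dom \<Gamma>) \<union> set (fv M)"] by auto

text \<open>Since the subject ranges over all representatives, the hypotheses apply to
  \<open>B[x ::= Var z]\<close> with a fresh \<open>z\<close> and to types found along the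
  way.\<close>

lemma dty_imp_typing:
  fixes \<Gamma> :: "('s, 'v::enumerated_var) ctx"
  shows "dok \<A> \<R> D \<Longrightarrow> D = dctx \<Gamma> \<Longrightarrow> distinct (ctx_dom \<Gamma>) \<Longrightarrow> ctx_ok \<A> \<R> \<Gamma>"
    and "dty \<A> \<R> D m a \<Longrightarrow> D = dctx \<Gamma> \<Longrightarrow> distinct (ctx_dom \<Gamma>) \<Longrightarrow> tr \<Gamma> M = m \<Longrightarrow>
      \<exists>A. tr \<Gamma> A = a \<and> typing \<A> \<R> \<Gamma> M A"
proof (induction arbitrary: \<Gamma> and \<Gamma> M rule: dok_dty.inducts)
  case dok_Nil
  then show ?case by (cases \<Gamma>) (auto intro: ok_Nil)
next
  case (dok_Cons D a s)
  then obtain x A \<Gamma>' where \<Gamma>: "\<Gamma> = (x, A) # \<Gamma>'" "a = tr \<Gamma>' A" "D = dctx \<Gamma>'"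
    by (metis dctx_ConsE)
  with dok_Cons.prems have d: "distinct (ctx_dom \<Gamma>')" "x \<notin> set (ctx_dom \<Gamma>')" by auto
  obtain S where "tr \<Gamma>' S = DSort s" "typing \<A> \<R> \<Gamma>' A S"
    using dok_Cons(4)[OF \<Gamma>(3) d(1) \<Gamma>(2)[symmetric]] by blast
  then show ?case
    using dok_Cons(2)[OF \<Gamma>(3) d(1)] d(2) unfolding \<Gamma>(1) by (auto dest: trs_eq_DSort intro: ok_Cons)
next
  case (dty_Sort D s1 s2)
  then have "M = Sort s1" by (auto dest: trs_eq_DSort)
  moreover have "typing \<A> \<R> \<Gamma> (Sort s1) (Sort s2)" using dty_Sort by (blast intro: ty_sort)
  ultimately show ?case by (intro exI[of _ "Sort s2"]) simp
next
  case (dty_Var D i)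
  then obtain x where M: "M = Var x" "env \<Gamma> x = i" by (cases M) auto
  have ok: "ctx_ok \<A> \<R> \<Gamma>" using dty_Var by blast
  have "x \<in> set (ctx_dom \<Gamma>)" using dty_Var(3) dty_Var.prems M(2) by (simp add: env_less_iff[symmetric] del: set_map)
  then obtain A where A: "(x, A) \<in> set \<Gamma>" by auto
  then have "tr \<Gamma> A = lookup D i" using typing_imp_dty(1)[OF ok] M(2) dty_Var.prems(1) by auto
  then show ?case using ty_var[OF ok A] M(1) by auto
next
  case (dty_Pi D a s1 b s2 s3)
  then obtain x A B where M: "M = Prod x A B" "tr \<Gamma> A = a" "trs B (lift_env x (dvars (env \<Gamma>))) = b"
    by (metis trs_eq_DBindE named_bind.simps(2))
  obtain z where z: "z \<notin> set (ctx_dom \<Gamma>)" "z \<notin> set (fv B)" by (rule fresh_ctxE)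
  obtain S1 where "tr \<Gamma> S1 = DSort s1" "typing \<A> \<R> \<Gamma> A S1"
    using dty_Pi(2)[OF dty_Pi.prems(1,2) M(2)] by blast
  then have A: "typing \<A> \<R> \<Gamma> A (Sort s1)" by (auto dest!: trs_eq_DSort)
  have "tr ((z, A) # \<Gamma>) (B[x ::= Var z]) = b"
    using z(2) M(3) tr_subst1_Cons[of z x B A \<Gamma>] by simp
  then obtain S2 where "tr ((z, A) # \<Gamma>) S2 = DSort s2"
      "typing \<A> \<R> ((z, A) # \<Gamma>) (B[x ::= Var z]) S2"
    using dty_Pi(4)[of "(z, A) # \<Gamma>"] dty_Pi.prems(1,2) M(2) z(1) by (auto simp del: env.simps)
  then have "typing \<A> \<R> ((z, A) # \<Gamma>) (B[x ::= Var z]) (Sort s2)" by (auto dest!: trs_eq_DSort)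
  then have "typing \<A> \<R> \<Gamma> M (Sort s3)"
    unfolding M(1) using A dty_Pi(5) z(2) by (auto intro: ty_prod)
  then show ?case by (intro exI[of _ "Sort s3"]) simp
next
  case (dty_Lam D a s1 m b s2 s3)
  then obtain x A P where M: "M = Lam x A P" "tr \<Gamma> A = a" "trs P (lift_env x (dvars (env \<Gamma>))) = m"
    by (metis trs_eq_DBindE named_bind.simps(1))
  obtain z where z: "z \<notin> set (ctx_dom \<Gamma>)" "z \<notin> set (fv P)" by (rule fresh_ctxE)
  let ?\<Gamma> = "(z, A) # \<Gamma>"
  have \<Gamma>: "a # D = dctx ?\<Gamma>" "distinct (ctx_dom ?\<Gamma>)"
    using dty_Lam.prems(1,2) M(2) z(1) by auto
  obtain S1 where "tr \<Gamma> S1 = DSort s1" "typing \<A> \<R> \<Gamma> A S1"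
    using dty_Lam(2)[OF dty_Lam.prems(1,2) M(2)] by blast
  then have A: "typing \<A> \<R> \<Gamma> A (Sort s1)" by (auto dest!: trs_eq_DSort)
  have "tr ?\<Gamma> (P[x ::= Var z]) = m"
    using z(2) M(3) tr_subst1_Cons[of z x P A \<Gamma>] by simp
  then obtain B where B: "tr ?\<Gamma> B = b" "typing \<A> \<R> ?\<Gamma> (P[x ::= Var z]) B"
    using dty_Lam(4)[OF \<Gamma>] by blast
  \<comment> \<open>The abstraction rule wants the codomain in the form
    \<open>B[y ::= Var z]\<close>. Taking \<open>z\<close> itself as the bound variable achieves
    this, but substitution may rename binders inside \<open>B\<close>, so
    \<open>B[z ::= Var z]\<close> is in general only \<alpha>-convertible to
    \<open>B\<close>.\<close>
  have B': "tr ?\<Gamma> (B[z ::= Var z]) = b"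
    using B(1) tr_subst1_Cons[of z z B A \<Gamma>] tr_Cons[of B z A \<Gamma>] by simp
  then obtain S2 where "tr ?\<Gamma> S2 = DSort s2" "typing \<A> \<R> ?\<Gamma> (B[z ::= Var z]) S2"
    using dty_Lam(6)[OF \<Gamma>] by blast
  then have Bs: "typing \<A> \<R> ?\<Gamma> (B[z ::= Var z]) (Sort s2)" by (auto dest!: trs_eq_DSort)
  have "B \<sim>\<alpha> B[z ::= Var z]"
    by (rule trs_eq_imp_alpha[OF _ inj_env[of ?\<Gamma>]]) (simp only: B(1) B')
  then have "typing \<A> \<R> ?\<Gamma> (P[x ::= Var z]) (B[z ::= Var z])"
    by (intro ty_conv[OF B(2) Bs] alpha_imp_beta_conv)
  then have "typing \<A> \<R> \<Gamma> M (Prod z A B)"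
    unfolding M(1) using A Bs dty_Lam(7) z(2) by (auto intro: ty_abs)
  moreover have "tr \<Gamma> (Prod z A B) = DPi a b"
    using M(2) B(1) tr_Cons[of B z A \<Gamma>] by simp
  ultimately show ?case by blast
next
  case (dty_App D m a b n s)
  then obtain P Q where M: "M = App P Q" "tr \<Gamma> P = m" "tr \<Gamma> Q = n" by (cases M) auto
  obtain T where T: "tr \<Gamma> T = DPi a b" "typing \<A> \<R> \<Gamma> P T"
    using dty_App(2)[OF dty_App.prems(1,2) M(2)] by blast
  then obtain x A B where AB: "T = Prod x A B" "tr \<Gamma> A = a" "trs B (lift_env x (dvars (env \<Gamma>))) = b"
    by (metis trs_eq_DBindE named_bind.simps(2))
  obtain A' where A': "tr \<Gamma> A' = a" "typing \<A> \<R> \<Gamma> Q A'"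
    using dty_App(4)[OF dty_App.prems(1,2) M(3)] by blast
  obtain S where "tr \<Gamma> S = DSort s" "typing \<A> \<R> \<Gamma> A S"
    using dty_App(6)[OF dty_App.prems(1,2) AB(2)] by blast
  then have A: "typing \<A> \<R> \<Gamma> A (Sort s)" by (auto dest!: trs_eq_DSort)
  have "A' \<sim>\<alpha> A" by (rule trs_eq_imp_alpha[OF _ inj_env[of \<Gamma>]]) (simp only: A'(1) AB(2))
  then have "typing \<A> \<R> \<Gamma> Q A" by (intro ty_conv[OF A'(2) A] alpha_imp_beta_conv)
  then have "typing \<A> \<R> \<Gamma> M (B[x ::= Q])" using T(2) unfolding M(1) AB(1) by (rule ty_app[rotated])
  moreover have "tr \<Gamma> (B[x ::= Q]) = dinst b n" by (simp add: trs_subst1 AB(3) M(3))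
  ultimately show ?case by blast
next
  case (dty_conv D m a b s)
  \<comment> \<open>Each index is named by its context variable. Typing confines the free indices of
    \<open>b\<close> to the context, so values of \<open>!\<close> out of range do not
    matter.\<close>
  define B :: "('s, 'v) trm" where "B = named b (\<lambda>i. Var (ctx_dom \<Gamma> ! i))"
  have "dfv b \<subseteq> {..<length \<Gamma>}" using dty_dfv[OF dty_conv(3)] dty_conv.prems(1) by simp
  then have "dsub (\<lambda>i. DVar (env \<Gamma> (ctx_dom \<Gamma> ! i))) b = dsub DVar b"
    by (intro dsub_cong) (use env_nth[OF dty_conv.prems(2)] in auto)
  then have B: "tr \<Gamma> B = b" by (simp add: B_def trs_named)
  then obtain S where "tr \<Gamma> S = DSort s" "typing \<A> \<R> \<Gamma> B S"
    using dty_conv(4)[OF dty_conv.prems(1,2)] by blast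
  then have Bs: "typing \<A> \<R> \<Gamma> B (Sort s)" by (auto dest!: trs_eq_DSort)
  obtain A where A: "tr \<Gamma> A = a" "typing \<A> \<R> \<Gamma> M A"
    using dty_conv(2)[OF dty_conv.prems] by blast
  have "A \<simeq>\<beta> B"
    using dty_conv(5) A(1) B by (intro dconv_imp_beta_conv[OF _ inj_env[of \<Gamma>]]) simp
  then have "typing \<A> \<R> \<Gamma> M B" by (rule ty_conv[OF A(2) Bs])
  then show ?case using B by blast
qed

lemma typing_iff_dty:
  assumes "distinct (ctx_dom \<Gamma>)"
  shows "typing \<A> \<R> \<Gamma> M A \<longleftrightarrow> dty \<A> \<R> (dctx \<Gamma>) (tr \<Gamma> M) (tr \<Gamma> A)"
proof
  assume d: "dty \<A> \<R> (dctx \<Gamma>) (tr \<Gamma> M) (tr \<Gamma> A)"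
  obtain A' where A': "tr \<Gamma> A' = tr \<Gamma> A" "typing \<A> \<R> \<Gamma> M A'"
    using dty_imp_typing(2)[OF d refl assms refl] by blast
  from dty_type_correct[OF d] show "typing \<A> \<R> \<Gamma> M A"
  proof (elim disjE exE)
    \<comment> \<open>A sort has only one representative, so no conversion is required, which is
      essential if it has no type.\<close>
    fix s assume "tr \<Gamma> A = DSort s"
    with A' show ?thesis by (metis trs_eq_DSort)
  next
    fix s assume "dty \<A> \<R> (dctx \<Gamma>) (tr \<Gamma> A) (DSort s)"
    then obtain S where "tr \<Gamma> S = DSort s" "typing \<A> \<R> \<Gamma> A S"
      using dty_imp_typing(2)[OF _ refl assms refl] by blast
    then have "typing \<A> \<R> \<Gamma> A (Sort s)" by (auto dest!: trs_eq_DSort)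
    moreover have "A' \<simeq>\<beta> A"
      by (intro alpha_imp_beta_conv trs_eq_imp_alpha[OF A'(1) inj_env])
    ultimately show ?thesis by (rule ty_conv[OF A'(2)])
  qed
qed (rule typing_imp_dty(2))

lemma typing_distinct: "typing \<A> \<R> \<Gamma> M A \<Longrightarrow> distinct (ctx_dom \<Gamma>)"
  by (induction rule: ctx_ok_typing.inducts(2)[where ?P1.0 = "\<lambda>\<Gamma>. distinct (ctx_dom \<Gamma>)"]) auto

end

section \<open>Transfer of subject reduction to named terms\<close>

lemma beta_eq_trs: "M \<rightarrow>\<beta>\<^sub>= N \<Longrightarrow> dbeta_eq (trs M \<theta>) (trs N \<theta>)"
  by (auto simp: beta_eq_def dbeta_eq_def intro: beta_trs)

lemma ctx_beta_eq_dctx: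
  assumes "\<Gamma> \<rightarrow>\<rightarrow>\<beta>\<^sub>= \<Delta>"
  shows "ctx_dom \<Gamma> = ctx_dom \<Delta>" "dctx_step (dctx \<Gamma>) (dctx \<Delta>)"
proof -
  have "ctx_dom \<Gamma> = ctx_dom \<Delta> \<and> dctx_step (dctx \<Gamma>) (dctx \<Delta>)"
    using assms unfolding ctx_beta_eq_def
  proof (induction rule: list_all2_induct)
    case (Cons p \<Gamma> q \<Delta>)
    then show ?case
      by (auto simp: env_cong[of \<Gamma> \<Delta>] split: prod.splits intro: beta_eq_trs)
  qed simp
  then show "ctx_dom \<Gamma> = ctx_dom \<Delta>" "dctx_step (dctx \<Gamma>) (dctx \<Delta>)" by auto
qed

theorem theorem2:
  fixes \<A> :: "'s \<Rightarrow> 's \<Rightarrow> bool" and \<R> :: "'s \<Rightarrow> 's \<Rightarrow> 's \<Rightarrow> bool"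
  shows "(\<forall>\<Gamma> \<Delta> :: ('s, 'v::enumerated_var) ctx.
            ctx_ok \<A> \<R> \<Gamma> \<longrightarrow> \<Gamma> \<rightarrow>\<rightarrow>\<beta>\<^sub>= \<Delta> \<longrightarrow> ctx_ok \<A> \<R> \<Delta>) \<and>
         (\<forall>(\<Gamma> :: ('s, 'v) ctx) \<Delta> M N A.
            typing \<A> \<R> \<Gamma> M A \<longrightarrow> \<Gamma> \<rightarrow>\<rightarrow>\<beta>\<^sub>= \<Delta> \<longrightarrow> M \<rightarrow>\<beta>\<^sub>= N \<longrightarrow> typing \<A> \<R> \<Delta> N A)"
proof (intro conjI allI impI)
  fix \<Gamma> \<Delta> :: "('s, 'v) ctx"
  assume ok: "ctx_ok \<A> \<R> \<Gamma>" and step: "\<Gamma> \<rightarrow>\<rightarrow>\<beta>\<^sub>= \<Delta>"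
  have "dok \<A> \<R> (dctx \<Delta>)"
    using dsubject_reduction(1)[OF _ ctx_beta_eq_dctx(2)[OF step]] typing_imp_dty(1)[OF ok] by blast
  then show "ctx_ok \<A> \<R> \<Delta>"
    using typing_imp_dty(1)[OF ok] ctx_beta_eq_dctx(1)[OF step] by (intro dty_imp_typing(1)) auto
next
  fix \<Gamma> \<Delta> :: "('s, 'v) ctx" and M N A
  assume M: "typing \<A> \<R> \<Gamma> M A" and step: "\<Gamma> \<rightarrow>\<rightarrow>\<beta>\<^sub>= \<Delta>" and MN: "M \<rightarrow>\<beta>\<^sub>= N"
  \<comment> \<open>The translation is still taken in \<Gamma>; as \<open>env\<close> depends only
    on the variables of a context, it agrees with the one in \<Delta>.\<close>
  have "dty \<A> \<R> (dctx \<Delta>) (tr \<Gamma> N) (tr \<Gamma> A)"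
    using dsubject_reduction(2)[OF typing_imp_dty(2)[OF M] ctx_beta_eq_dctx(2)[OF step]]
      beta_eq_trs[OF MN] by blast
  then show "typing \<A> \<R> \<Delta> N A"
    using typing_iff_dty[of \<Delta>] typing_distinct[OF M] ctx_beta_eq_dctx(1)[OF step]
      env_cong[of \<Gamma> \<Delta>] by simp
qed

end
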